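(* Let $M\ge1$, and $a_1,\dots,a_M\in[0,1]$ with $\sum_i a_i=1$. Let $V_1,\dots,V_M:\mathbb{R}\to\mathbb{R}$ be even polynomials of the form $$V_k(x)=-\frac{\theta_k^{(2)}}2x^2+\sum_{\ell=2}^{p_k}\frac{\theta_k^{(2\ell)}}{2\ell}x^{2\ell},\qquad p_k\ge2,\ \theta_k^{(2)}>0,\ \theta_k^{(2p_k)}>0,\ \theta_k^{(2i)}\ge0\text{ for }2\le i\le p_k-1,$$ let $\alpha_{ij}\ge0$ for all $i,j$ and $\alpha_{ii}>0$ for all $i$, let $F_{ij}(x)=\frac{\alpha_{ij}}2x^2$, and let $\sigma_1,\dots,\sigma_M>0$. Assume the structural condition: for all $1\le i,j\le M$, $$\frac{\alpha_{ij}}{\sigma_i^2}=\frac{\alpha_{1j}}{\sigma_1^2},\qquad \frac{V_i}{\sigma_i^2}=\frac{V_1}{\sigma_1^2},$$ and write $\frac{\alpha_{ij}}{\sigma_i^2}=\frac{\alpha_j}{\sigma^2}$ and $\frac{V_i}{\sigma_i^2}=\frac{\overline V}{\sigma^2}$ with $\sigma>0$, coefficients $\alpha_j$ and a potential $\overline V$. Put $\overline\alpha_1=\sum_{\ell=1}^M a_\ell\alpha_\ell$ and $\overline V^0(x)=\overline V(x)+\frac{\overline\alpha_1}2x^2$. Then a phase transition occurs. More precisely: each stationary state is of the form $\mu_\sigma\otimes\cdots\otimes\mu_\sigma$ (all $M$ components equal to $\mu_\sigma$), where $\mu_\sigma$ is a probability measure on $\mathbb{R}$ of the form $$\mu_\sigma(dx)=\frac{\exp\{-\frac2{\sigma^2}(\overline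 V^0(x)-Ax)\}}{\int_{\mathbb{R}}\exp\{-\frac2{\sigma^2}(\overline V^0(y)-Ay)\}dy}\,dx,$$ and $A\in\mathbb{R}$ satisfies $$\frac{A}{\overline\alpha_1}=\frac{\int_{\mathbb{R}}x\exp\{-\frac2{\sigma^2}(\overline V^0(x)-Ax)\}dx}{\int_{\mathbb{R}}\exp\{-\frac2{\sigma^2}(\overline V^0(x)-Ax)\}dx}.$$ Moreover, there exists $\sigma_c>0$ such that if $\sigma\ge\sigma_c$ the system admits a unique stationary state (corresponding to $A=0$), and if $\sigma<\sigma_c$ there are exactly three stationary states, associated respectively with $A=0$, one $A>0$ and one $A<0$. Furthermore, $\sigma_c$ is the unique positive real number satisfying $$\frac{\int_{\mathbb{R}}x^2\exp\{-\frac{2}{\sigma_c^2}\overline V^0(x)\}dx}{\int_{\mathbb{R}}\exp\{-\frac2{\sigma_c^2}\overline V^0(x)\}dx}=\frac{\sigma_c^2}{2\overline\alpha_1}.$$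
   Context: The system is $dX^k_t=-V_k'(X^k_t)dt-\sum_{\ell=1}^M a_\ell (F_{k\ell}'*\mu^\ell_t)(X^k_t)dt+\sigma_k dW^k_t$, $k=1,\dots,M$, $\mu^\ell_t$ being the law of $X^\ell_t$. A stationary state is an $M$-tuple $(\mu^1,\dots,\mu^M)$ of probability measures on $\mathbb{R}$ with densities satisfying $\mu^k(x)=Z_k^{-1}\exp[-\frac{2}{\sigma_k^2}(V_k(x)+\sum_\ell a_\ell F_{k\ell}*\mu^\ell(x))]$ with normalization constants $Z_k$. In the phase-transition statement, $\overline V$, the $\alpha_j$ and the $a_j$ (hence $\overline V^0$ and $\overline\alpha_1$) are fixed and $\sigma$ varies; $\sigma_c$ depends only on $\overline V$ and $\overline\alpha_1$. *)

theory Defs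
  imports "HOL-Probability.Probability"
begin

definition confining_potential :: "(real \<Rightarrow> real) \<Rightarrow> bool" where
  "confining_potential V \<longleftrightarrow> (\<exists>p \<theta>. 2 \<le> (p::nat) \<and> \<theta> 2 > (0::real) \<and> \<theta> (2 * p) > 0 \<and>
     (\<forall>i\<in>{2..p - 1}. \<theta> (2 * i) \<ge> 0) \<and>
     (\<forall>x. V x = - (\<theta> 2 / 2) * x ^ 2 + (\<Sum>l = 2..p. \<theta> (2 * l) / (2 * real l) * x ^ (2 * l))))"

text \<open>Species are indexed by \<open>{1..M}\<close>; \<open>s k\<close> is the diffusion coefficient of species \<open>k\<close>.\<close>

definition multi_species_system ::
  "nat \<Rightarrow> (nat \<Rightarrow> real) \<Rightarrow> (nat \<Rightarrow> real \<Rightarrow> real) \<Rightarrow> (nat \<Rightarrow> nat \<Rightarrow> real) \<Rightarrow> (nat \<Rightarrow> real) \<Rightarrow> bool" where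
  "multi_species_system M a V \<alpha> s \<longleftrightarrow>
     1 \<le> M \<and>
     (\<forall>i\<in>{1..M}. 0 \<le> a i \<and> a i \<le> 1) \<and> (\<Sum>i = 1..M. a i) = 1 \<and>
     (\<forall>k\<in>{1..M}. confining_potential (V k)) \<and>
     (\<forall>i\<in>{1..M}. \<forall>j\<in>{1..M}. \<alpha> i j \<ge> 0) \<and> (\<forall>i\<in>{1..M}. \<alpha> i i > 0) \<and>
     (\<forall>i\<in>{1..M}. s i > 0)"

definition structural_condition ::
  "nat \<Rightarrow> (nat \<Rightarrow> real \<Rightarrow> real) \<Rightarrow> (nat \<Rightarrow> nat \<Rightarrow> real) \<Rightarrow> (nat \<Rightarrow> real) \<Rightarrow> bool" where
  "structural_condition M V \<alpha> s \<longleftrightarrow>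
     (\<forall>i\<in>{1..M}. \<forall>j\<in>{1..M}. \<alpha> i j / (s i)\<^sup>2 = \<alpha> 1 j / (s 1)\<^sup>2) \<and>
     (\<forall>i\<in>{1..M}. \<forall>x. V i x / (s i)\<^sup>2 = V 1 x / (s 1)\<^sup>2)"

text \<open>The structural condition determines \<open>\<sigma>\<close>, \<open>Vb\<close>, \<open>\<alpha>b\<close> only up to a common scaling, so
  they are carried as additional data.\<close>

definition common_form ::
  "nat \<Rightarrow> (nat \<Rightarrow> real \<Rightarrow> real) \<Rightarrow> (nat \<Rightarrow> nat \<Rightarrow> real) \<Rightarrow> (nat \<Rightarrow> real) \<Rightarrow>
   real \<Rightarrow> (real \<Rightarrow> real) \<Rightarrow> (nat \<Rightarrow> real) \<Rightarrow> bool" where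
  "common_form M V \<alpha> s \<sigma> Vb \<alpha>b \<longleftrightarrow>
     \<sigma> > 0 \<and>
     (\<forall>i\<in>{1..M}. \<forall>j\<in>{1..M}. \<alpha> i j / (s i)\<^sup>2 = \<alpha>b j / \<sigma>\<^sup>2) \<and>
     (\<forall>i\<in>{1..M}. \<forall>x. V i x / (s i)\<^sup>2 = Vb x / \<sigma>\<^sup>2)"

definition convolution_measure :: "(real \<Rightarrow> real) \<Rightarrow> real measure \<Rightarrow> real \<Rightarrow> real" where
  "convolution_measure f \<mu> x = (LINT y|\<mu>. f (x - y))"

text \<open>Tuples are extensional functions on \<open>{1..M}\<close>, so that counting stationary states is
  meaningful. Integrability is required explicitly because Bochner integrals of
  non-integrable functions are \<open>0\<close> by convention.\<close>

definition stationary_state ::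
  "nat \<Rightarrow> (nat \<Rightarrow> real) \<Rightarrow> (nat \<Rightarrow> real \<Rightarrow> real) \<Rightarrow> (nat \<Rightarrow> nat \<Rightarrow> real \<Rightarrow> real) \<Rightarrow> (nat \<Rightarrow> real) \<Rightarrow>
   (nat \<Rightarrow> real measure) \<Rightarrow> bool" where
  "stationary_state M a V F s \<mu> \<longleftrightarrow>
     \<mu> \<in> extensional {1..M} \<and>
     (\<forall>k\<in>{1..M}. prob_space (\<mu> k) \<and> sets (\<mu> k) = sets borel) \<and>
     (\<forall>k\<in>{1..M}. \<forall>l\<in>{1..M}. \<forall>x. integrable (\<mu> l) (\<lambda>y. F k l (x - y))) \<and>
     (\<forall>k\<in>{1..M}. \<exists>Z>0. \<mu> k = density lborel (\<lambda>x. ennreal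
        (exp (- (2 / (s k)\<^sup>2) * (V k x + (\<Sum>l = 1..M. a l * convolution_measure (F k l) (\<mu> l) x))) / Z)))"

definition gibbs_weight :: "(real \<Rightarrow> real) \<Rightarrow> real \<Rightarrow> real \<Rightarrow> real \<Rightarrow> real" where
  "gibbs_weight U \<sigma> A x = exp (- (2 / \<sigma>\<^sup>2) * (U x - A * x))"

definition gibbs_measure :: "(real \<Rightarrow> real) \<Rightarrow> real \<Rightarrow> real \<Rightarrow> real measure" where
  "gibbs_measure U \<sigma> A =
     density lborel (\<lambda>x. ennreal (gibbs_weight U \<sigma> A x / (LINT y|lborel. gibbs_weight U \<sigma> A y)))"

definition self_consistent :: "(real \<Rightarrow> real) \<Rightarrow> real \<Rightarrow> real \<Rightarrow> real \<Rightarrow> bool" where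
  "self_consistent U \<beta> \<sigma> A \<longleftrightarrow>
     A / \<beta> = (LINT x|lborel. x * gibbs_weight U \<sigma> A x) / (LINT x|lborel. gibbs_weight U \<sigma> A x)"

definition associated_state ::
  "nat \<Rightarrow> (real \<Rightarrow> real) \<Rightarrow> real \<Rightarrow> real \<Rightarrow> real \<Rightarrow> (nat \<Rightarrow> real measure) \<Rightarrow> bool" where
  "associated_state M U \<beta> \<sigma> A \<mu> \<longleftrightarrow>
     self_consistent U \<beta> \<sigma> A \<and> \<mu> = (\<lambda>k\<in>{1..M}. gibbs_measure U \<sigma> A)"

definition critical_equation :: "(real \<Rightarrow> real) \<Rightarrow> real \<Rightarrow> real \<Rightarrow> bool" where
  "critical_equation U \<beta> \<sigma> \<longleftrightarrow>
     (LINT x|lborel. x\<^sup>2 * exp (- (2 / \<sigma>\<^sup>2) * U x)) / (LINT x|lborel. exp (- (2 / \<sigma>\<^sup>2) * U x))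
       = \<sigma>\<^sup>2 / (2 * \<beta>)"

end

theory Submission
  imports Defs
begin

text \<open>
  A stationary state has all components equal to a Gibbs measure with a linear tilt \<open>A\<close>, so it
  suffices to count the self-consistent \<open>A\<close>. Write \<open>V' x = x * q x\<close> for the common potential, with
  \<open>q\<close> even and increasing in \<open>\<bar>x\<bar>\<close>, and \<open>\<tau> = 2 / \<sigma>\<^sup>2\<close>. Integration by parts turns the self-consistency
  equation into the vanishing of the integral of \<open>V' x * sinh (\<tau> A x) * exp (- \<tau> U x)\<close>. Since \<open>V'\<close> changes
  sign once on the positive axis and \<open>sinh (b x) / sinh (a x)\<close> is increasing for \<open>a < b\<close>, this function
  of \<open>A\<close> changes sign at most once on the positive axis, and it does so iff its slope at 0, the
  integral of \<open>x * V' x * exp (- \<tau> U x)\<close>, is negative. After the rescaling \<open>y = sqrt \<tau> * x\<close> the same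
  single-crossing argument shows that this slope changes sign exactly once as \<open>\<tau>\<close> varies; its
  zero is the critical equation.
\<close>

subsection \<open>Functions of exponential growth and single-crossing integrals\<close>

text \<open>The self-consistency equation balances \<open>A\<close> against \<beta> times a tilted
  mean. Integration by parts makes \<open>A\<close> cancel against the \<beta> part of
  \<open>U'\<close>. What remains depends on \<open>A\<close> only through the hyperbolic sine, and
  its sign is carried by \<open>V'\<close>, which does not move with \<open>A\<close>. Two
  parameters are then compared by matching their integrands at the fixed zero \<open>r\<close> and
  subtracting, so that only the sign of the reference integral enters. The critical equation resists
  this in the variable \<open>x\<close>: its integrand
  \<open>\<beta> * \<tau> * x\<^sup>2 - 1\<close> changes sign at a point that moves with \<tau>.
  Rescaling freezes that point at \<open>1 / sqrt \<beta>\<close>. The comparisons run over the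
  whole line, where their integrands are even. \<open>exp_bounded\<close> is the class of test
  functions: it is closed under sums and products, contains polynomials and exponentials, and is
  absorbed by the weight because \<open>V\<close> outgrows every multiple of
  \<open>x\<^sup>2\<close>.\<close>

definition exp_bounded :: "(real \<Rightarrow> real) \<Rightarrow> bool" where
  "exp_bounded f \<longleftrightarrow> f \<in> borel_measurable borel \<and> (\<exists>C b. \<forall>x. \<bar>f x\<bar> \<le> C * exp (b * \<bar>x\<bar>))"

lemma exp_boundedE:
  assumes "exp_bounded f"
  obtains C b where "C \<ge> 0" "b \<ge> 0" "\<And>x. \<bar>f x\<bar> \<le> C * exp (b * \<bar>x\<bar>)"
proof -
  obtain C b where *: "\<And>x. \<bar>f x\<bar> \<le> C * exp (b * \<bar>x\<bar>)"
    using assms unfolding exp_bounded_def by blast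
  have "\<bar>f x\<bar> \<le> \<bar>C\<bar> * exp (\<bar>b\<bar> * \<bar>x\<bar>)" for x
  proof -
    have "C * exp (b * \<bar>x\<bar>) \<le> \<bar>C\<bar> * exp (\<bar>b\<bar> * \<bar>x\<bar>)"
      by (intro mult_mono) (auto intro: mult_right_mono)
    with *[of x] show ?thesis by linarith
  qed
  then show ?thesis by (intro that[of "\<bar>C\<bar>" "\<bar>b\<bar>"]) auto
qed

lemma exp_bounded_measurable: "exp_bounded f \<Longrightarrow> f \<in> borel_measurable borel"
  by (simp add: exp_bounded_def)

lemma exp_bounded_const [intro, simp]: "exp_bounded (\<lambda>x. c)"
  unfolding exp_bounded_def by (intro conjI exI[of _ "\<bar>c\<bar>"] exI[of _ 0]) auto

lemma exp_bounded_ident [intro, simp]: "exp_bounded (\<lambda>x. x)"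
proof -
  have "\<bar>x\<bar> \<le> 1 * exp (1 * \<bar>x\<bar>)" for x :: real
    using order.trans[OF _ exp_ge_add_one_self[of "\<bar>x\<bar>"]] by simp
  then show ?thesis unfolding exp_bounded_def by (intro conjI exI allI) (measurable, blast)
qed

lemma exp_bounded_exp [intro, simp]: "exp_bounded (\<lambda>x. exp (a * x))"
proof -
  have "\<bar>exp (a * x)\<bar> \<le> 1 * exp (\<bar>a\<bar> * \<bar>x\<bar>)" for x :: real
    by (simp flip: abs_mult)
  then show ?thesis unfolding exp_bounded_def by (intro conjI exI allI) (measurable, blast)
qed

lemma exp_bounded_exp_abs [intro, simp]: "exp_bounded (\<lambda>x. exp (a * \<bar>x\<bar>))"
  unfolding exp_bounded_def by (intro conjI exI[of _ 1] exI[of _ a]) auto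

lemma exp_bounded_add [intro]:
  assumes "exp_bounded f" "exp_bounded g"
  shows "exp_bounded (\<lambda>x. f x + g x)"
proof -
  obtain C b where f: "C \<ge> 0" "b \<ge> 0" "\<And>x. \<bar>f x\<bar> \<le> C * exp (b * \<bar>x\<bar>)"
    using assms(1) by (rule exp_boundedE) blast
  obtain D c where g: "D \<ge> 0" "c \<ge> 0" "\<And>x. \<bar>g x\<bar> \<le> D * exp (c * \<bar>x\<bar>)"
    using assms(2) by (rule exp_boundedE) blast
  have "\<bar>f x + g x\<bar> \<le> (C + D) * exp ((b + c) * \<bar>x\<bar>)" for x
  proof -
    have "C * exp (b * \<bar>x\<bar>) \<le> C * exp ((b + c) * \<bar>x\<bar>)" "D * exp (c * \<bar>x\<bar>) \<le> D * exp ((b + c) * \<bar>x\<bar>)"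
      using f g by (auto intro!: mult_left_mono mult_right_mono)
    then show ?thesis 
      using f(3)[of x] g(3)[of x] abs_triangle_ineq[of "f x" "g x"] unfolding distrib_right[of C D]
      by (meson add_mono order.trans)
  qed
  then show ?thesis
    using assms unfolding exp_bounded_def by (intro conjI exI allI borel_measurable_add) auto
qed

lemma exp_bounded_mult [intro]:
  assumes "exp_bounded f" "exp_bounded g"
  shows "exp_bounded (\<lambda>x. f x * g x)"
proof -
  obtain C b where f: "C \<ge> 0" "b \<ge> 0" "\<And>x. \<bar>f x\<bar> \<le> C * exp (b * \<bar>x\<bar>)"
    using assms(1) by (rule exp_boundedE) blast
  obtain D c where g: "D \<ge> 0" "c \<ge> 0" "\<And>x. \<bar>g x\<bar> \<le> D * exp (c * \<bar>x\<bar>)"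
    using assms(2) by (rule exp_boundedE) blast
  have "\<bar>f x * g x\<bar> \<le> (C * D) * exp ((b + c) * \<bar>x\<bar>)" for x
  proof -
    have "\<bar>f x * g x\<bar> \<le> (C * exp (b * \<bar>x\<bar>)) * (D * exp (c * \<bar>x\<bar>))"
      unfolding abs_mult using f g by (intro mult_mono) auto
    also have "\<dots> = (C * D) * exp ((b + c) * \<bar>x\<bar>)"
      by (simp add: exp_add algebra_simps)
    finally show ?thesis .
  qed
  then show ?thesis
    using assms unfolding exp_bounded_def by (intro conjI exI allI borel_measurable_times) auto
qed

lemma exp_bounded_minus [intro]: "exp_bounded f \<Longrightarrow> exp_bounded (\<lambda>x. - f x)"
  using exp_bounded_mult[OF exp_bounded_const[of "-1"], of f] by simp

lemma exp_bounded_diff [intro]: "exp_bounded f \<Longrightarrow> exp_bounded g \<Longrightarrow> exp_bounded (\<lambda>x. f x - g x)"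
  using exp_bounded_add[OF _ exp_bounded_minus, of f g] by simp

lemma exp_bounded_power [intro]: "exp_bounded f \<Longrightarrow> exp_bounded (\<lambda>x. f x ^ n)"
  by (induction n) auto

lemma exp_bounded_ident_power [intro, simp]: "exp_bounded (\<lambda>x. x ^ n)"
  by (rule exp_bounded_power) simp

lemma exp_bounded_sum [intro]:
  "(\<And>i. i \<in> I \<Longrightarrow> exp_bounded (f i)) \<Longrightarrow> exp_bounded (\<lambda>x. \<Sum>i\<in>I. f i x)"
  by (induction I rule: infinite_finite_induct) auto

lemma exp_bounded_abs [intro]: "exp_bounded f \<Longrightarrow> exp_bounded (\<lambda>x. \<bar>f x\<bar>)"
  unfolding exp_bounded_def by auto

lemma exp_bounded_sinh [intro]: "exp_bounded (\<lambda>x. sinh (a * x))"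
proof -
  have "exp_bounded (\<lambda>x. 1/2 * (exp (a * x) - exp ((- a) * x)))" by (intro exp_bounded_mult exp_bounded_diff exp_bounded_const exp_bounded_exp)
  then show ?thesis by (simp add: sinh_def)
qed

section \<open>Integrals over the real line: positivity, comparison, vanishing boundary
  terms\<close>

lemma lborel_integral_pos:
  fixes f :: "real \<Rightarrow> real"
  assumes "integrable lborel f" "\<And>x. f x \<ge> 0" "c < d" "\<And>x. c < x \<Longrightarrow> x < d \<Longrightarrow> f x > 0"
  shows "(LINT x|lborel. f x) > 0"
proof -
  have "(LINT x|lborel. f x) \<noteq> 0"
  proof
    assume "(LINT x|lborel. f x) = 0"
    then have zero: "AE x in lborel. f x = 0"
      using assms by (subst integral_nonneg_eq_0_iff_AE[symmetric]) auto
    have "AE x in lborel. x \<notin> {c<..<d}"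
      by (rule eventually_mono[OF zero]) (use assms(4) in force)
    then have "emeasure lborel {c<..<d} = 0"
      by (subst (asm) AE_iff_measurable[OF _ refl]) (auto simp: greaterThanLessThan_def greaterThan_def lessThan_def Int_def)
    then show False using assms(3) by simp
  qed
  moreover have "(LINT x|lborel. f x) \<ge> 0" using assms by auto
  ultimately show ?thesis by linarith
qed

text \<open>Subtracting \<open>k\<close> times the reference integrand leaves a nonnegative
  function, so a nonnegative integral of \<open>f\<close> forces a positive one of \<open>g\<close>.
  The interval only supplies strictness.\<close>

lemma single_crossing_integral_pos:
  fixes f g :: "real \<Rightarrow> real"
  assumes "integrable lborel f" "integrable lborel g" "k \<ge> 0" "(LINT x|lborel. f x) \<ge> 0"
    and "\<And>x. k * f x \<le> g x" "c < d" "\<And>x. c < x \<Longrightarrow> x < d \<Longrightarrow> k * f x < g x"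
  shows "(LINT x|lborel. g x) > 0"
proof -
  have "(LINT x|lborel. g x - k * f x) > 0"
    using assms by (intro lborel_integral_pos[of _ c d]) (auto simp: algebra_simps)
  moreover have "(LINT x|lborel. g x - k * f x) = (LINT x|lborel. g x) - k * (LINT x|lborel. f x)"
    using assms by simp
  moreover have "k * (LINT x|lborel. f x) \<ge> 0" using assms by simp
  ultimately show ?thesis by linarith
qed

text \<open>The fundamental theorem on \<open>[-n, n]\<close> leaves boundary terms that vanish in
  the limit; dominated convergence passes from the truncated integrals to the full one.\<close>

lemma integral_derivative_eq_0:
  fixes F f :: "real \<Rightarrow> real"
  assumes deriv: "\<And>x. (F has_real_derivative f x) (at x)"
    and cont: "continuous_on UNIV f" and int: "integrable lborel f"
    and top: "(F \<longlongrightarrow> 0) at_top" and bot: "(F \<longlongrightarrow> 0) at_bot"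
  shows "(LINT x|lborel. f x) = 0"
proof -
  let ?s = "\<lambda>n x. indicator {- real n..real n} x *\<^sub>R f x"
  have "(\<lambda>n. LINT x|lborel. ?s n x) \<longlonglongrightarrow> (LINT x|lborel. f x)"
  proof (rule integral_dominated_convergence[where w = "\<lambda>x. \<bar>f x\<bar>"])
    show "AE x in lborel. (\<lambda>n. ?s n x) \<longlonglongrightarrow> f x"
    proof (rule AE_I2, rule tendsto_eventually)
      fix x :: real
      obtain N where "\<bar>x\<bar> \<le> real N" using real_arch_simple by blast
      then show "\<forall>\<^sub>F n in sequentially. ?s n x = f x"
        by (intro eventually_sequentiallyI[of N]) (auto simp: indicator_def)
    qed
  qed (use int in \<open>auto simp: indicator_def\<close>)
  moreover have "(LINT x|lborel. ?s n x) = F (real n) - F (- real n)" for n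
    using deriv continuous_on_subset[OF cont]
    by (intro integral_FTC_atLeastAtMost)
       (auto simp: has_real_derivative_iff_has_vector_derivative[symmetric] intro: has_field_derivative_at_within)
  moreover have "(\<lambda>n. F (real n) - F (- real n)) \<longlonglongrightarrow> 0 - 0"
    by (intro tendsto_diff filterlim_compose[OF top] filterlim_compose[OF bot] filterlim_real_sequentially
          filterlim_compose[OF filterlim_uminus_at_bot_at_top])
  ultimately show ?thesis
    by (metis (no_types, lifting) LIMSEQ_unique diff_zero ext)
qed

lemma continuous_on_integral_dominated:
  fixes h :: "real \<Rightarrow> real \<Rightarrow> real"
  assumes "\<And>t. h t \<in> borel_measurable borel" "integrable lborel w"
    and "\<And>t x. t \<in> S \<Longrightarrow> \<bar>h t x\<bar> \<le> w x" "\<And>x. continuous_on S (\<lambda>t. h t x)"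
  shows "continuous_on S (\<lambda>t. LINT x|lborel. h t x)"
  unfolding continuous_on_sequentially comp_def
proof (intro ballI allI impI)
  fix X :: "nat \<Rightarrow> real" and t assume t: "t \<in> S" and X: "(\<forall>n. X n \<in> S) \<and> X \<longlonglongrightarrow> t"
  show "(\<lambda>n. LINT x|lborel. h (X n) x) \<longlonglongrightarrow> (LINT x|lborel. h t x)"
  proof (rule integral_dominated_convergence[where w = w])
    show "AE x in lborel. (\<lambda>n. h (X n) x) \<longlonglongrightarrow> h t x"
      using assms(4) t X unfolding continuous_on_sequentially comp_def by blast
  qed (use assms X in auto)
qed

lemma integral_lborel_minus:
  fixes f :: "real \<Rightarrow> real"
  shows "(LINT x|lborel. f (- x)) = (LINT x|lborel. f x)"
  using lborel_integral_real_affine[of "-1" f 0] by simp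

text \<open>\<open>D\<close> is the numerator of the derivative of
  \<open>sinh (b * t) / sinh (a * t)\<close>. It vanishes at 0, and its own derivative is a positive
  multiple of a product of two hyperbolic sines.\<close>

lemma sinh_ratio_strict_mono:
  fixes a b x y :: real
  assumes "0 < a" "a < b" "0 < x" "x < y"
  shows "sinh (b * x) * sinh (a * y) < sinh (b * y) * sinh (a * x)"
proof -
  define D where "D = (\<lambda>x. b * cosh (b * x) * sinh (a * x) - a * cosh (a * x) * sinh (b * x))"
  have D: "D x > 0" if "x > 0" for x
  proof -
    have "D 0 < D x"
    proof (rule DERIV_pos_imp_increasing_open[OF that])
      fix t assume t: "0 < t" "t < x"
      have "(D has_real_derivative (b\<^sup>2 - a\<^sup>2) * sinh (b * t) * sinh (a * t)) (at t)"
        unfolding D_def by (auto intro!: derivative_eq_intros simp: algebra_simps power2_eq_square)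
      moreover have "(b\<^sup>2 - a\<^sup>2) * sinh (b * t) * sinh (a * t) > 0"
        using assms t by (intro mult_pos_pos) (auto simp: power_strict_mono)
      ultimately show "\<exists>y. (D has_real_derivative y) (at t) \<and> y > 0" by blast
    qed (auto simp: D_def intro!: continuous_intros)
    then show ?thesis by (simp add: D_def)
  qed
  have "sinh (b * x) / sinh (a * x) < sinh (b * y) / sinh (a * y)"
  proof (rule DERIV_pos_imp_increasing[OF assms(4)])
    fix t assume t: "x \<le> t" "t \<le> y"
    have s: "sinh (a * t) > 0" using assms t by simp
    have "((\<lambda>t. sinh (b * t) / sinh (a * t)) has_real_derivative D t / (sinh (a * t))\<^sup>2) (at t)"
      unfolding D_def using s
      by (auto intro!: derivative_eq_intros simp: algebra_simps power2_eq_square)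
    moreover have "D t / (sinh (a * t))\<^sup>2 > 0" using D[of t] s assms t by simp
    ultimately show "\<exists>d. ((\<lambda>t. sinh (b * t) / sinh (a * t)) has_real_derivative d) (at t) \<and> d > 0" by blast
  qed
  then show ?thesis using assms by (simp add: field_simps)
qed

text \<open>Limiting case of the preceding comparison, the smaller parameter tending to 0; it serves
  to compare the slope \<open>G\<close> with values of \<open>K\<close>.\<close>

lemma sinh_over_ident_strict_mono:
  fixes a x y :: real
  assumes "0 < a" "0 < x" "x < y"
  shows "sinh (a * x) * y < sinh (a * y) * x"
proof -
  define D where "D = (\<lambda>x. a * x * cosh (a * x) - sinh (a * x))"
  have D: "D x > 0" if "x > 0" for x
  proof -
    have "D 0 < D x"
    proof (rule DERIV_pos_imp_increasing_open[OF that])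
      fix t assume t: "0 < t" "t < x"
      have "(D has_real_derivative a\<^sup>2 * t * sinh (a * t)) (at t)"
        unfolding D_def by (auto intro!: derivative_eq_intros simp: algebra_simps power2_eq_square)
      moreover have "a\<^sup>2 * t * sinh (a * t) > 0"
        using assms t by (intro mult_pos_pos) auto
      ultimately show "\<exists>y. (D has_real_derivative y) (at t) \<and> y > 0" by blast
    qed (auto simp: D_def intro!: continuous_intros)
    then show ?thesis by (simp add: D_def)
  qed
  have "sinh (a * x) / x < sinh (a * y) / y"
  proof (rule DERIV_pos_imp_increasing[OF assms(3)])
    fix t assume t: "x \<le> t" "t \<le> y"
    have "((\<lambda>t. sinh (a * t) / t) has_real_derivative D t / t\<^sup>2) (at t)"
      unfolding D_def using assms t
      by (auto intro!: derivative_eq_intros simp: algebra_simps power2_eq_square)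
    moreover have "D t / t\<^sup>2 > 0" using D[of t] assms t by simp
    ultimately show "\<exists>d. ((\<lambda>t. sinh (a * t) / t) has_real_derivative d) (at t) \<and> d > 0" by blast
  qed
  then show ?thesis using assms by (simp add: field_simps)
qed

text \<open>With \<open>y = e * x\<close> this bounds the difference quotients of
  \<open>exp (e * x)\<close> in \<open>e\<close> at 0, uniformly for
  \<open>0 < e <= 1\<close>.\<close>

lemma abs_exp_minus_one_le: "\<bar>exp y - 1\<bar> \<le> \<bar>y\<bar> * exp \<bar>y\<bar>" for y :: real
proof (cases "y \<ge> 0")
  case True
  have "1 - y \<le> exp (- y)" using exp_ge_add_one_self[of "- y"] by simp
  then have "exp y * (1 - y) \<le> exp y * exp (- y)" by (intro mult_left_mono) auto
  then have "exp y * (1 - y) \<le> 1" by (simp add: exp_minus)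
  with True show ?thesis by (simp add: algebra_simps)
next
  case False
  have "1 + y \<le> exp y" by (rule exp_ge_add_one_self)
  moreover have "exp y \<le> 1" using False by simp
  moreover have "- y * 1 \<le> - y * exp (- y)" using False by (intro mult_left_mono) auto
  ultimately have "1 - exp y \<le> - y * exp (- y)" by linarith
  then show ?thesis using False by simp
qed

subsection \<open>Double-well potentials and their weights\<close>

text \<open>\<open>V' x = x * q x\<close>, so that \<open>r\<close> is the positive minimizer of \<open>V\<close>.\<close>

locale double_well =
  fixes V q :: "real \<Rightarrow> real" and r \<beta> :: real
  assumes \<beta>_pos: "\<beta> > 0"
    and V_even: "V (- x) = V x"
    and V_deriv: "(V has_real_derivative x * q x) (at x)"
    and V_growth: "\<exists>C. \<forall>x. V x \<ge> K * x\<^sup>2 - C"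
    and q_even: "q (- x) = q x"
    and q_cont: "continuous_on UNIV q"
    and q_bounded: "exp_bounded q"
    and q_mono: "0 \<le> x \<Longrightarrow> x < y \<Longrightarrow> q x < q y"
    and r_pos: "r > 0"
    and q_r: "q r = 0"
begin

definition U :: "real \<Rightarrow> real" where
  "U x = V x + \<beta> / 2 * x\<^sup>2"

text \<open>Here \<tau> stands for \<open>2 / \<sigma>\<^sup>2\<close>. The integral is left
  unnormalized because later only signs and zeros matter, which a positive normalization does not
  affect.\<close>

definition Wint :: "real \<Rightarrow> (real \<Rightarrow> real) \<Rightarrow> real" where
  "Wint \<tau> f = (LINT x|lborel. f x * exp (- (\<tau> * U x)))"

lemma U_even: "U (- x) = U x"
  by (simp add: U_def V_even)

lemma q_abs: "q \<bar>x\<bar> = q x"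
  by (cases "x \<ge> 0") (auto simp: q_even)

lemma q_neg: "\<bar>x\<bar> < r \<Longrightarrow> q x < 0"
  using q_mono[of "\<bar>x\<bar>" r] q_r q_abs[of x] by simp

lemma q_pos: "\<bar>x\<bar> > r \<Longrightarrow> q x > 0"
  using q_mono[of r "\<bar>x\<bar>"] q_r q_abs[of x] r_pos by simp

lemma q_zero: "\<bar>x\<bar> = r \<Longrightarrow> q x = 0"
  using q_abs[of x] q_r by simp

lemma U_deriv [derivative_intros]: "(U has_real_derivative x * (q x + \<beta>)) (at x)"
proof -
  have "((\<lambda>x. V x + \<beta> / 2 * x\<^sup>2) has_real_derivative x * (q x + \<beta>)) (at x)"
    by (auto intro!: derivative_eq_intros V_deriv simp: algebra_simps)
  then show ?thesis by (simp add: U_def[abs_def])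
qed

lemma U_cont: "continuous_on S U"
  using U_deriv by (meson DERIV_isCont continuous_at_imp_continuous_on)

lemma U_measurable [measurable]: "U \<in> borel_measurable borel"
  by (intro borel_measurable_continuous_onI U_cont)

lemma weight_gaussian_bound:
  assumes "\<tau> > 0"
  obtains C where "C \<ge> 0" "\<And>x. exp (b * \<bar>x\<bar>) * exp (- (\<tau> * U x)) \<le> C * exp (- x\<^sup>2 / 2)"
proof -
  \<comment> \<open>Multiplication by \<tau> turns the growth constant \<open>2 / \<tau>\<close>
    into 2: one \<open>x\<^sup>2\<close> absorbs \<open>b * \<bar>x\<bar>\<close>, the other leaves
    room for the Gaussian.\<close>
  obtain C0 where C0: "\<And>x. V x \<ge> (2 / \<tau>) * x\<^sup>2 - C0" using V_growth by blast
  have "exp (b * \<bar>x\<bar>) * exp (- (\<tau> * U x)) \<le> exp (\<tau> * C0 + b\<^sup>2) * exp (- x\<^sup>2 / 2)" for x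
  proof -
    have "\<beta> / 2 * x\<^sup>2 \<ge> 0" using \<beta>_pos by simp
    then have "U x \<ge> (2 / \<tau>) * x\<^sup>2 - C0" using C0[of x] unfolding U_def by linarith
    then have "\<tau> * U x \<ge> \<tau> * ((2 / \<tau>) * x\<^sup>2 - C0)" using assms by (intro mult_left_mono) auto
    then have "\<tau> * U x \<ge> 2 * x\<^sup>2 - \<tau> * C0" using assms by (simp add: algebra_simps)
    moreover have "2 * (b * \<bar>x\<bar>) \<le> x\<^sup>2 + b\<^sup>2"
      using sum_squares_bound[of b "\<bar>x\<bar>"] by (simp add: mult.assoc)
    then have "b * \<bar>x\<bar> \<le> x\<^sup>2 + b\<^sup>2"
      using zero_le_power2[of b] zero_le_power2[of x] by linarith
    ultimately have "b * \<bar>x\<bar> - \<tau> * U x \<le> \<tau> * C0 + b\<^sup>2 - x\<^sup>2 / 2" using zero_le_power2[of x] by linarith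
    then show ?thesis by (simp add: mult_exp_exp)
  qed
  then show ?thesis by (intro that[of "exp (\<tau> * C0 + b\<^sup>2)"]) auto
qed

lemma exp_bounded_weight_bound:
  assumes "\<tau> > 0" "exp_bounded f"
  obtains C where "C \<ge> 0" "\<And>x. \<bar>f x * exp (- (\<tau> * U x))\<bar> \<le> C * exp (- x\<^sup>2 / 2)"
proof -
  obtain D b where D: "D \<ge> 0" "b \<ge> 0" "\<And>x. \<bar>f x\<bar> \<le> D * exp (b * \<bar>x\<bar>)"
    using assms(2) by (rule exp_boundedE) blast
  obtain C where C: "C \<ge> 0" "\<And>x. exp (b * \<bar>x\<bar>) * exp (- (\<tau> * U x)) \<le> C * exp (- x\<^sup>2 / 2)"
    using weight_gaussian_bound[OF assms(1)] by blast
  have "\<bar>f x * exp (- (\<tau> * U x))\<bar> \<le> (D * C) * exp (- x\<^sup>2 / 2)" for x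
  proof -
    have "\<bar>f x * exp (- (\<tau> * U x))\<bar> \<le> (D * exp (b * \<bar>x\<bar>)) * exp (- (\<tau> * U x))"
      using D(3)[of x] by (simp add: abs_mult)
    also have "\<dots> \<le> D * (C * exp (- x\<^sup>2 / 2))"
      using mult_left_mono[OF C(2)[of x] D(1)] by (simp add: mult.assoc)
    finally show ?thesis by (simp add: mult.assoc)
  qed
  then show ?thesis using that[of "D * C"] C D by simp
qed

lemma integrable_weight:
  assumes "\<tau> > 0" "exp_bounded f"
  shows "integrable lborel (\<lambda>x. f x * exp (- (\<tau> * U x)))"
proof -
  obtain C where C: "\<And>x. \<bar>f x * exp (- (\<tau> * U x))\<bar> \<le> C * exp (- x\<^sup>2 / 2)"
    using exp_bounded_weight_bound[OF assms] by blast
  have "integrable lborel (\<lambda>x. sqrt (2 * pi) * C * (std_normal_density x * x ^ 0))"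
    by (intro integrable_mult_right integrable_std_normal_moment)
  then have "integrable lborel (\<lambda>x. C * exp (- x\<^sup>2 / 2))"
    by (simp add: std_normal_density_def)
  then show ?thesis
    using C exp_bounded_measurable[OF assms(2)]
    
    by (elim Bochner_Integration.integrable_bound) (auto intro!: AE_I2 order.trans[OF _ abs_ge_self])
qed

lemma Wint_add: "\<tau> > 0 \<Longrightarrow> exp_bounded f \<Longrightarrow> exp_bounded g \<Longrightarrow> Wint \<tau> (\<lambda>x. f x + g x) = Wint \<tau> f + Wint \<tau> g"
  unfolding Wint_def by (simp add: distrib_right integrable_weight)

lemma Wint_diff: "\<tau> > 0 \<Longrightarrow> exp_bounded f \<Longrightarrow> exp_bounded g \<Longrightarrow> Wint \<tau> (\<lambda>x. f x - g x) = Wint \<tau> f - Wint \<tau> g"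
  unfolding Wint_def by (simp add: left_diff_distrib integrable_weight)

lemma Wint_cmult: "Wint \<tau> (\<lambda>x. c * f x) = c * Wint \<tau> f"
  unfolding Wint_def by (simp add: mult.assoc)

lemma Wint_minus_arg: "Wint \<tau> (\<lambda>x. f (- x)) = Wint \<tau> f"
  using integral_lborel_minus[of "\<lambda>x. f x * exp (- (\<tau> * U x))"] by (simp add: Wint_def U_even)

lemma Wint_pos:
  assumes "\<tau> > 0" "exp_bounded f" "\<And>x. f x > 0"
  shows "Wint \<tau> f > 0"
  unfolding Wint_def using assms
  by (intro lborel_integral_pos[of _ 0 1] integrable_weight) (auto intro: less_imp_le)

text \<open>The derivative of \<open>f x * exp (- (\<tau> * U x))\<close> integrates to 0, since the
  Gaussian bound kills the boundary terms; \<open>x * (q x + \<beta>)\<close> is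
  \<open>U'\<close>.\<close>

lemma Wint_by_parts:
  assumes "\<tau> > 0" "exp_bounded f" "exp_bounded f'" "continuous_on UNIV f'"
    and deriv: "\<And>x. (f has_real_derivative f' x) (at x)"
  shows "Wint \<tau> f' = \<tau> * Wint \<tau> (\<lambda>x. f x * (x * (q x + \<beta>)))"
proof -
  let ?F = "\<lambda>x. f x * exp (- (\<tau> * U x))"
  let ?g = "\<lambda>x. f' x - \<tau> * (f x * (x * (q x + \<beta>)))"
  have bnd: "exp_bounded (\<lambda>x. \<tau> * (f x * (x * (q x + \<beta>))))"
    using assms q_bounded by (intro exp_bounded_mult exp_bounded_add) auto
  have int: "integrable lborel (\<lambda>x. ?g x * exp (- (\<tau> * U x)))"
    using assms bnd by (intro integrable_weight exp_bounded_diff) auto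
  obtain C where C: "\<And>x. \<bar>?F x\<bar> \<le> C * exp (- x\<^sup>2 / 2)"
    using exp_bounded_weight_bound[OF assms(1,2)] by blast
  have top: "((\<lambda>x::real. C * exp (- x\<^sup>2 / 2)) \<longlongrightarrow> 0) at_top" by real_asymp
  have bot: "((\<lambda>x::real. C * exp (- x\<^sup>2 / 2)) \<longlongrightarrow> 0) at_bot" by real_asymp
  have cf: "continuous_on UNIV f"
    using deriv by (meson DERIV_isCont continuous_at_imp_continuous_on)
  have "(LINT x|lborel. ?g x * exp (- (\<tau> * U x))) = 0"
  proof (rule integral_derivative_eq_0[where F = ?F])
    show "(?F has_real_derivative ?g x * exp (- (\<tau> * U x))) (at x)" for x
      by (auto intro!: derivative_eq_intros U_deriv deriv simp: algebra_simps)
    show "continuous_on UNIV (\<lambda>x. ?g x * exp (- (\<tau> * U x)))"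
      using assms by (intro continuous_intros q_cont U_cont cf) auto
    show "(?F \<longlongrightarrow> 0) at_top" "(?F \<longlongrightarrow> 0) at_bot"
      using C by (auto intro!: Lim_null_comparison[OF _ top] Lim_null_comparison[OF _ bot])
  qed (rule int)
  then have "Wint \<tau> ?g = 0" by (simp add: Wint_def)
  then show ?thesis using Wint_diff[OF assms(1,3) bnd] by (simp add: Wint_cmult)
qed

text \<open>The integrand \<open>x * q x\<close> changes sign exactly at \<open>\<plusminus>r\<close> and \<open>g / f\<close> is monotone in \<open>\<bar>x\<bar>\<close>, hence
  \<open>x * q x * (g x - g r / f r * f x)\<close> is nonnegative.\<close>

lemma Wint_crossing:
  assumes \<tau>: "\<tau> > 0" and f: "exp_bounded f" and g: "exp_bounded g"
    and odd: "\<And>x. f (- x) = - f x" "\<And>x. g (- x) = - g x"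
    and pos: "\<And>x. x > 0 \<Longrightarrow> f x > 0" "\<And>x. x > 0 \<Longrightarrow> g x > 0"
    and ratio: "\<And>x y. 0 < x \<Longrightarrow> x < y \<Longrightarrow> g x * f y < g y * f x"
    and ge: "Wint \<tau> (\<lambda>x. x * q x * f x) \<ge> 0"
  shows "Wint \<tau> (\<lambda>x. x * q x * g x) > 0"
proof -
  define k where "k = g r / f r"
  have k: "k > 0" using pos r_pos by (simp add: k_def)
  have strict: "k * (x * q x * f x) < x * q x * g x" if x: "x > 0" "x \<noteq> r" for x
  proof (cases "x < r")
    case True
    have "g x < k * f x" using ratio[OF x(1) True] pos(1)[OF r_pos] by (simp add: k_def field_simps)
    moreover have "x * q x < 0" using q_neg[of x] x True by (simp add: mult_pos_neg)
    ultimately show ?thesis using mult_strict_left_mono_neg by (metis mult.left_commute)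
  next
    case False
    then have "k * f x < g x" using ratio[OF r_pos, of x] x pos(1)[OF r_pos] by (simp add: k_def field_simps)
    moreover have "x * q x > 0" using q_pos[of x] x False by simp
    ultimately show ?thesis using mult_strict_left_mono by (metis mult.left_commute)
  qed
  \<comment> \<open>Both sides are even in \<open>x\<close>, as \<open>f\<close> and
    \<open>g\<close> are odd and \<open>q\<close> is even, so the nonnegative half-line
    decides.\<close>
  have le: "k * (x * q x * f x) \<le> x * q x * g x" for x
  proof -
    have "k * (y * q y * f y) \<le> y * q y * g y" if "y \<ge> 0" for y
      using strict[of y] that q_r by (cases "y = 0 \<or> y = r") auto
    from this[of x] this[of "- x"] show ?thesis
      by (cases "x \<ge> 0") (auto simp: odd q_even)
  qed
  show ?thesis unfolding Wint_def
  proof (rule single_crossing_integral_pos[where k = k and c = 0 and d = r])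
    show "integrable lborel (\<lambda>x. x * q x * f x * exp (- (\<tau> * U x)))"
      "integrable lborel (\<lambda>x. x * q x * g x * exp (- (\<tau> * U x)))"
      using \<tau> f g q_bounded by (auto intro!: integrable_weight exp_bounded_mult)
    show "(LINT x|lborel. x * q x * f x * exp (- (\<tau> * U x))) \<ge> 0" using ge by (simp add: Wint_def)
    show "k * (x * q x * f x * exp (- (\<tau> * U x))) \<le> x * q x * g x * exp (- (\<tau> * U x))" for x
      using mult_right_mono[OF le[of x], of "exp (- (\<tau> * U x))"] by (simp add: mult.assoc)
    show "k * (x * q x * f x * exp (- (\<tau> * U x))) < x * q x * g x * exp (- (\<tau> * U x))"
      if "0 < x" "x < r" for x
      using mult_strict_right_mono[OF strict[of x], of "exp (- (\<tau> * U x))"] that by (simp add: mult.assoc)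
  qed (use k r_pos in auto)
qed

subsection \<open>The self-consistency equation\<close>

text \<open>By parts, \<open>\<tau> A\<close> is a zero of \<open>K \<tau>\<close> iff \<open>A\<close> is self-consistent, and
  \<open>G \<tau> = 0\<close> iff \<open>\<sigma>\<close> is critical, where \<open>\<tau> = 2 / \<sigma>\<^sup>2\<close>. \<open>G \<tau>\<close> is the slope of \<open>K \<tau>\<close> at 0.\<close>

definition K :: "real \<Rightarrow> real \<Rightarrow> real" where
  "K \<tau> a = Wint \<tau> (\<lambda>x. x * q x * exp (a * x))"

definition G :: "real \<Rightarrow> real" where
  "G \<tau> = Wint \<tau> (\<lambda>x. x * q x * x)"

lemma K_bounded: "exp_bounded (\<lambda>x. x * q x * exp (a * x))"
  using q_bounded by (intro exp_bounded_mult) auto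

lemma K_uminus: "K \<tau> (- a) = - K \<tau> a"
proof -
  have "K \<tau> (- a) = Wint \<tau> (\<lambda>x. - 1 * (x * q x * exp (a * x)))"
    using Wint_minus_arg[of \<tau> "\<lambda>x. x * q x * exp ((- a) * x)"] by (simp add: K_def q_even)
  then show ?thesis by (simp only: Wint_cmult K_def)
qed

lemma K_0: "K \<tau> 0 = 0"
  using K_uminus[of \<tau> 0] by simp

text \<open>\<open>x * q x\<close> is odd, so only the odd part of the exponential survives against
  the even weight. Unlike \<open>exp\<close>, \<open>sinh\<close> is odd, as
  \<open>Wint_crossing\<close> requires.\<close>

lemma K_sinh:
  assumes "\<tau> > 0"
  shows "K \<tau> a = Wint \<tau> (\<lambda>x. x * q x * sinh (a * x))"
proof -
  have "2 * K \<tau> a = K \<tau> a - K \<tau> (- a)" by (simp add: K_uminus)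
  also have "\<dots> = Wint \<tau> (\<lambda>x. x * q x * exp (a * x) - x * q x * exp (- a * x))"
    unfolding K_def using assms K_bounded by (simp only: Wint_diff)
  also have "(\<lambda>x. x * q x * exp (a * x) - x * q x * exp (- a * x)) = (\<lambda>x. 2 * (x * q x * sinh (a * x)))"
    by (auto simp: sinh_def algebra_simps)
  also have "Wint \<tau> \<dots> = 2 * Wint \<tau> (\<lambda>x. x * q x * sinh (a * x))"
    by (rule Wint_cmult)
  finally show ?thesis by simp
qed

text \<open>\<open>Wint_crossing\<close> for two hyperbolic sines. Consequently
  \<open>K \<tau>\<close> has at most one positive zero.\<close>

lemma K_pos_mono:
  assumes "\<tau> > 0" "0 < a" "a < b" "K \<tau> a \<ge> 0"
  shows "K \<tau> b > 0"
  using assms Wint_crossing[of \<tau> "\<lambda>x. sinh (a * x)" "\<lambda>x. sinh (b * x)"] sinh_ratio_strict_mono[of a b]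
  by (simp add: K_sinh exp_bounded_sinh)

text \<open>The same comparison with the identity as reference function: the slope at 0 takes the
  place of the value at a smaller parameter.\<close>

lemma K_pos_if_G_nonneg:
  assumes "\<tau> > 0" "G \<tau> \<ge> 0" "a > 0"
  shows "K \<tau> a > 0"
  using assms Wint_crossing[of \<tau> "\<lambda>x. x" "\<lambda>x. sinh (a * x)"] sinh_over_ident_strict_mono[of a]
  by (simp add: K_sinh G_def exp_bounded_sinh)

lemma K_cont:
  assumes "\<tau> > 0"
  shows "continuous_on {a..b} (K \<tau>)"
  unfolding K_def Wint_def
proof (rule continuous_on_integral_dominated)
  let ?c = "\<bar>a\<bar> + \<bar>b\<bar>"
  show "integrable lborel (\<lambda>x. (\<bar>x * q x\<bar> * exp (?c * \<bar>x\<bar>)) * exp (- (\<tau> * U x)))"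
    using assms q_bounded by (intro integrable_weight exp_bounded_mult exp_bounded_abs) auto
  show "\<bar>x * q x * exp (t * x) * exp (- (\<tau> * U x))\<bar> \<le> (\<bar>x * q x\<bar> * exp (?c * \<bar>x\<bar>)) * exp (- (\<tau> * U x))"
    if "t \<in> {a..b}" for t x
  proof -
    have "t * x \<le> \<bar>t\<bar> * \<bar>x\<bar>" by (simp flip: abs_mult)
    also have "\<dots> \<le> ?c * \<bar>x\<bar>" using that by (intro mult_right_mono) auto
    finally show ?thesis by (auto simp: abs_mult intro!: mult_right_mono mult_left_mono)
  qed
  show "(\<lambda>x. x * q x * exp (t * x) * exp (- (\<tau> * U x))) \<in> borel_measurable borel" for t
    using exp_bounded_measurable[OF q_bounded] by measurable
qed (intro continuous_intros)

text \<open>After division by \<open>sinh (b * r)\<close>, the region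
  \<open>\<bar>x\<bar> <= r\<close> costs at most the integral of \<open>n\<^sub>1\<close>, which
  does not depend on \<open>b\<close>. On \<open>[2r, 3r]\<close> the doubling formula and
  \<open>2 * cosh u >= u\<close> give a gain linear in \<open>b\<close>.\<close>

lemma K_eventually_pos:
  assumes \<tau>: "\<tau> > 0"
  shows "\<exists>b>a. K \<tau> b > 0"
proof -
  define n\<^sub>1 where "n\<^sub>1 = (\<lambda>x. \<bar>x * q x\<bar>)"
  define n\<^sub>2 where "n\<^sub>2 = (\<lambda>x. indicator {2 * r..3 * r} x * (x * q x))"
  have n\<^sub>1: "exp_bounded n\<^sub>1" unfolding n\<^sub>1_def using q_bounded by (intro exp_bounded_abs exp_bounded_mult) auto
  have ind: "exp_bounded (indicator A)" if "A \<in> sets borel" for A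
    unfolding exp_bounded_def using that by (intro conjI exI[of _ 1] exI[of _ 0]) (auto simp: indicator_def)
  have n\<^sub>2: "exp_bounded n\<^sub>2" unfolding n\<^sub>2_def using q_bounded by (intro exp_bounded_mult ind) auto
  have n\<^sub>2_pos: "n\<^sub>2 x > 0" if "2 * r \<le> x" "x \<le> 3 * r" for x
    using that q_pos[of x] r_pos by (simp add: n\<^sub>2_def)
  have n\<^sub>2_ge: "n\<^sub>2 x \<ge> 0" for x using n\<^sub>2_pos[of x] by (cases "x \<in> {2 * r..3 * r}") (auto simp: n\<^sub>2_def)
  have I\<^sub>2: "Wint \<tau> n\<^sub>2 > 0" unfolding Wint_def
    using n\<^sub>2_pos n\<^sub>2_ge r_pos by (intro lborel_integral_pos[of _ "2 * r" "3 * r"] integrable_weight \<tau> n\<^sub>2) auto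
  \<comment> \<open>The quotient makes the linear gain outweigh the cost; the summands
    \<open>\<bar>a\<bar>\<close> and 1 place \<open>b\<close> beyond \<open>a\<close> and 0.\<close>
  define b where "b = \<bar>a\<bar> + \<bar>Wint \<tau> n\<^sub>1\<bar> / (r * Wint \<tau> n\<^sub>2) + 1"
  have b: "b > a" "b > 0" "b * r * Wint \<tau> n\<^sub>2 > Wint \<tau> n\<^sub>1"
  proof -
    have "\<bar>Wint \<tau> n\<^sub>1\<bar> / (r * Wint \<tau> n\<^sub>2) \<ge> 0" using r_pos I\<^sub>2 by simp
    then show "b > a" "b > 0" unfolding b_def by linarith+
    have "\<bar>Wint \<tau> n\<^sub>1\<bar> / (r * Wint \<tau> n\<^sub>2) < b" unfolding b_def by linarith
    then have "\<bar>Wint \<tau> n\<^sub>1\<bar> < b * (r * Wint \<tau> n\<^sub>2)" using r_pos I\<^sub>2 by (simp add: field_simps)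
    then show "b * r * Wint \<tau> n\<^sub>2 > Wint \<tau> n\<^sub>1" by (simp add: mult.assoc)
  qed
  have pw: "sinh (b * r) * (b * r * n\<^sub>2 x - n\<^sub>1 x) \<le> x * q x * sinh (b * x)" for x
  proof -
    have br: "sinh (b * r) > 0" using b r_pos by simp
    show ?thesis
    proof (cases "\<bar>x\<bar> \<le> r")
      case True
      then have "n\<^sub>2 x = 0" using r_pos by (auto simp: n\<^sub>2_def indicator_def)
      moreover have "\<bar>sinh (b * x)\<bar> \<le> sinh (b * r)"
      proof -
        have "b * x \<le> b * r" "- (b * r) \<le> b * x"
          using True b mult_left_mono[of "- r" x b] by auto
        then have "sinh (b * x) \<le> sinh (b * r)" "sinh (- (b * r)) \<le> sinh (b * x)"
          by (simp_all only: sinh_real_le_iff)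
        then show ?thesis by (simp add: abs_le_iff)
      qed
      then have "\<bar>x * q x * sinh (b * x)\<bar> \<le> n\<^sub>1 x * sinh (b * r)"
        unfolding n\<^sub>1_def abs_mult[of "x * q x"] by (intro mult_left_mono) auto
      ultimately show ?thesis by (simp add: mult.commute)
    next
      case False
      have qx: "q x > 0" using q_pos False by simp
      have ge: "x * q x * sinh (b * x) \<ge> 0"
        using qx b by (cases "x \<ge> 0") (auto intro: mult_nonneg_nonneg mult_nonpos_nonpos simp: mult_nonneg_nonpos mult_nonneg_nonpos2)
      have n1: "n\<^sub>1 x \<ge> 0" by (simp add: n\<^sub>1_def)
      show ?thesis
      proof (cases "x \<in> {2 * r..3 * r}")
        case True
        have "sinh (b * r) * (b * r) \<le> sinh (b * x)"
        proof -
          have "b * r \<le> 2 * cosh (b * r)"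
          proof -
            have "b * r \<le> exp (b * r)" using exp_ge_add_one_self[of "b * r"] by linarith
            also have "\<dots> \<le> 2 * cosh (b * r)" by (simp add: cosh_def)
            finally show ?thesis .
          qed
          then have "sinh (b * r) * (b * r) \<le> sinh (b * r) * (2 * cosh (b * r))"
            using br by (intro mult_left_mono) auto
          also have "\<dots> = sinh (2 * (b * r))" by (simp add: sinh_double)
          also have "\<dots> \<le> sinh (b * x)" using True b by simp
          finally show ?thesis .
        qed
        then have "x * q x * (sinh (b * r) * (b * r)) \<le> x * q x * sinh (b * x)"
          using True r_pos qx by (intro mult_left_mono) auto
        moreover have "n\<^sub>2 x = x * q x" using True by (simp add: n\<^sub>2_def)
        moreover have "sinh (b * r) * n\<^sub>1 x \<ge> 0" using br n1 by simp
        ultimately show ?thesis by (simp add: algebra_simps)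
      next
        case False
        then have "n\<^sub>2 x = 0" by (simp add: n\<^sub>2_def)
        moreover have "sinh (b * r) * n\<^sub>1 x \<ge> 0" using br n1 by simp
        ultimately show ?thesis using ge by simp
      qed
    qed
  qed
  have "0 < sinh (b * r) * (b * r * Wint \<tau> n\<^sub>2 - Wint \<tau> n\<^sub>1)"
    using b r_pos by simp
  also have "\<dots> = Wint \<tau> (\<lambda>x. sinh (b * r) * (b * r * n\<^sub>2 x - n\<^sub>1 x))"
    using \<tau> n\<^sub>1 n\<^sub>2 by (subst Wint_cmult, subst Wint_diff) (auto simp: Wint_cmult)
  also have "\<dots> \<le> Wint \<tau> (\<lambda>x. x * q x * sinh (b * x))"
    unfolding Wint_def
    using \<tau> n\<^sub>1 n\<^sub>2 q_bounded pw
    by (intro integral_mono integrable_weight exp_bounded_mult exp_bounded_diff exp_bounded_sinh mult_right_mono) auto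
  finally show ?thesis using b \<tau> by (auto simp: K_sinh)
qed

text \<open>\<open>K \<tau> e / e\<close> tends to \<open>G \<tau>\<close> as \<open>e\<close>
  decreases to 0, so \<open>K \<tau>\<close> nonnegative on the positive axis would force
  \<open>G \<tau> >= 0\<close>. A single sequence suffices for this, and dominated convergence takes
  the place of differentiation under the integral.\<close>

lemma K_neg_near_0:
  assumes \<tau>: "\<tau> > 0" and G: "G \<tau> < 0"
  shows "\<exists>a>0. K \<tau> a < 0"
proof (rule ccontr)
  assume "\<not> ?thesis"
  then have ge: "K \<tau> a \<ge> 0" if "a > 0" for a using that by force
  define e where "e = (\<lambda>n::nat. 1 / real (Suc n))"
  have e: "e n > 0" "e n \<le> 1" for n by (auto simp: e_def)
  let ?h = "\<lambda>n x. x * q x * ((exp (e n * x) - 1) / e n)"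
  have quotient: "Wint \<tau> (?h n) = K \<tau> (e n) / e n" for n
  proof -
    \<comment> \<open>The factor \<open>exp (0 * x)\<close> is kept so that the second term is
      literally \<open>K \<tau> 0\<close>, which vanishes.\<close>
    have "Wint \<tau> (\<lambda>x. x * q x * exp (e n * x) - x * q x * exp (0 * x)) = K \<tau> (e n) - K \<tau> 0"
      unfolding K_def by (rule Wint_diff[OF \<tau> K_bounded K_bounded])
    moreover have "?h n = (\<lambda>x. (1 / e n) * (x * q x * exp (e n * x) - x * q x * exp (0 * x)))"
      using e[of n] by (auto simp: field_simps)
    ultimately show ?thesis using Wint_cmult[of \<tau> "1 / e n"] by (simp add: K_0)
  qed
  have "(\<lambda>n. Wint \<tau> (?h n)) \<longlonglongrightarrow> G \<tau>"
    unfolding G_def Wint_def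
  proof (rule integral_dominated_convergence)
    let ?w = "\<lambda>x. (\<bar>x * q x * x\<bar> * exp (1 * \<bar>x\<bar>)) * exp (- (\<tau> * U x))"
    show "integrable lborel ?w"
      using \<tau> q_bounded by (intro integrable_weight exp_bounded_mult exp_bounded_abs exp_bounded_exp_abs) auto
    show "AE x in lborel. norm (?h n x * exp (- (\<tau> * U x))) \<le> ?w x" for n
    proof (rule AE_I2)
      fix x
      have "\<bar>(exp (e n * x) - 1) / e n\<bar> \<le> \<bar>e n * x\<bar> * exp \<bar>e n * x\<bar> / e n"
        using abs_exp_minus_one_le[of "e n * x"] e[of n] by (simp add: divide_right_mono)
      also have "\<dots> = \<bar>x\<bar> * exp \<bar>e n * x\<bar>" using e[of n] by (simp add: abs_mult)
      also have "\<dots> \<le> \<bar>x\<bar> * exp (1 * \<bar>x\<bar>)"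
        using e[of n] by (intro mult_left_mono) (auto simp: abs_mult mult_left_le_one_le)
      finally have "\<bar>x * q x\<bar> * \<bar>(exp (e n * x) - 1) / e n\<bar> \<le> \<bar>x * q x\<bar> * (\<bar>x\<bar> * exp (1 * \<bar>x\<bar>))"
        by (intro mult_left_mono) auto
      then show "norm (?h n x * exp (- (\<tau> * U x))) \<le> ?w x"
        using mult_right_mono[of "\<bar>x * q x\<bar> * \<bar>(exp (e n * x) - 1) / e n\<bar>" _ "exp (- (\<tau> * U x))"]
        unfolding real_norm_def abs_mult[of "?h n x"] abs_mult[of "x * q x"] abs_exp_cancel
        by (metis abs_mult exp_ge_zero mult.assoc)
    qed
    show "AE x in lborel. (\<lambda>n. ?h n x * exp (- (\<tau> * U x))) \<longlonglongrightarrow> x * q x * x * exp (- (\<tau> * U x))"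
    proof (rule AE_I2)
      fix x
      have "((\<lambda>a. exp (a * x)) has_real_derivative x) (at 0)"
        by (auto intro!: derivative_eq_intros)
      then have "((\<lambda>a. (exp (a * x) - 1) / a) \<longlongrightarrow> x) (at 0)"
        by (simp add: has_field_derivative_iff)
      moreover have "filterlim e (at 0) sequentially"
        using lim_1_over_n[THEN LIMSEQ_Suc] e(1) unfolding e_def
        by (auto simp: filterlim_at)
      ultimately have "(\<lambda>n. (exp (e n * x) - 1) / e n) \<longlonglongrightarrow> x"
        by (rule filterlim_compose)
      then show "(\<lambda>n. ?h n x * exp (- (\<tau> * U x))) \<longlonglongrightarrow> x * q x * x * exp (- (\<tau> * U x))"
        by (intro tendsto_intros)
    qed
  qed (use exp_bounded_measurable[OF q_bounded] in measurable)
  moreover have "Wint \<tau> (?h n) \<ge> 0" for n using ge[of "e n"] e[of n] unfolding quotient by simp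
  ultimately have "G \<tau> \<ge> 0" by (intro LIMSEQ_le_const) auto
  with G show False by simp
qed

lemma K_zeros_supercritical:
  assumes "\<tau> > 0" "G \<tau> \<ge> 0"
  shows "K \<tau> a = 0 \<longleftrightarrow> a = 0"
  using K_pos_if_G_nonneg[OF assms, of a] K_pos_if_G_nonneg[OF assms, of "- a"] K_0[of \<tau>] K_uminus[of \<tau> a]
  by (cases a "0 :: real" rule: linorder_cases) auto

text \<open>Negative near 0 and positive far out give a zero by continuity.
  \<open>K_pos_mono\<close>, used with two zeros in either order, excludes a second positive one;
  oddness gives the mirror image.\<close>

lemma K_zeros_subcritical:
  assumes \<tau>: "\<tau> > 0" and G: "G \<tau> < 0"
  shows "\<exists>a>0. \<forall>b. K \<tau> b = 0 \<longleftrightarrow> b \<in> {0, a, - a}"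
proof -
  obtain c where c: "c > 0" "K \<tau> c < 0" using K_neg_near_0[OF assms] by blast
  obtain d where d: "d > c" "K \<tau> d > 0" using K_eventually_pos[OF \<tau>] by blast
  obtain a where a: "c \<le> a" "K \<tau> a = 0"
    using IVT'[of "K \<tau>" c 0 d] c d K_cont[OF \<tau>] by auto
  have uniq: "b = a" if "b > 0" "K \<tau> b = 0" for b
    using K_pos_mono[OF \<tau>, of a b] K_pos_mono[OF \<tau>, of b a] a c that
    by (cases a b rule: linorder_cases) auto
  have "K \<tau> b = 0 \<longleftrightarrow> b \<in> {0, a, - a}" for b
    using uniq[of b] uniq[of "- b"] a K_0[of \<tau>] K_uminus[of \<tau>]
    by (cases b "0 :: real" rule: linorder_cases) auto
  then show ?thesis using a c by (intro exI[of _ a]) auto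
qed

subsection \<open>The critical inverse temperature\<close>

lemma G_bounded: "exp_bounded (\<lambda>x. x * q x * x)"
  using q_bounded by (intro exp_bounded_mult) auto

text \<open>By parts with the identity as \<open>f\<close>. The left side is the critical equation
  with denominators cleared, which says that the mean of \<open>x\<^sup>2\<close> is
  \<open>1 / (\<beta> * \<tau>)\<close>.\<close>

lemma Wint_critical_eq:
  assumes "\<tau> > 0"
  shows "Wint \<tau> (\<lambda>x. \<beta> * \<tau> * x\<^sup>2 - 1) = - (\<tau> * G \<tau>)"
proof -
  have "Wint \<tau> (\<lambda>x. x * (x * (q x + \<beta>))) = Wint \<tau> (\<lambda>x. x * q x * x + \<beta> * x\<^sup>2)"
    by (simp add: algebra_simps power2_eq_square)
  also have "\<dots> = G \<tau> + \<beta> * Wint \<tau> (\<lambda>x. x\<^sup>2)"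
    unfolding G_def using assms G_bounded
    by (subst Wint_add) (auto simp: Wint_cmult)
  finally have "Wint \<tau> (\<lambda>x. 1) = \<tau> * (G \<tau> + \<beta> * Wint \<tau> (\<lambda>x. x\<^sup>2))"
    using Wint_by_parts[of \<tau> "\<lambda>x. x" "\<lambda>x. 1"] assms by simp
  moreover have "Wint \<tau> (\<lambda>x. \<beta> * \<tau> * x\<^sup>2 - 1) = \<beta> * \<tau> * Wint \<tau> (\<lambda>x. x\<^sup>2) - Wint \<tau> (\<lambda>x. 1)"
    using assms by (subst Wint_diff) (auto simp: Wint_cmult)
  ultimately show ?thesis by (simp add: algebra_simps)
qed

text \<open>Substituting \<open>x = y / sqrt \<tau>\<close> gives the prefactor
  \<open>\<beta> * y\<^sup>2 - 1\<close>, whose zeros are the same for all \<tau>. The factor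
  \<open>sqrt \<tau>\<close> is the Jacobian.\<close>

lemma Wint_rescaled:
  assumes "\<tau> > 0"
  shows "integrable lborel (\<lambda>y. (\<beta> * y\<^sup>2 - 1) * exp (- (\<tau> * U (y / sqrt \<tau>))))"
    and "(LINT y|lborel. (\<beta> * y\<^sup>2 - 1) * exp (- (\<tau> * U (y / sqrt \<tau>)))) = - (sqrt \<tau> * \<tau> * G \<tau>)"
proof -
  let ?f = "\<lambda>x. (\<beta> * \<tau> * x\<^sup>2 - 1) * exp (- (\<tau> * U x))"
  have eq: "?f (0 + (1 / sqrt \<tau>) * y) = (\<beta> * y\<^sup>2 - 1) * exp (- (\<tau> * U (y / sqrt \<tau>)))" for y
    using assms by (simp add: power_divide)
  have "integrable lborel ?f" using assms by (intro integrable_weight exp_bounded_diff exp_bounded_mult exp_bounded_power) auto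
  from lborel_integrable_real_affine[OF this, of "1 / sqrt \<tau>" 0] assms
  show "integrable lborel (\<lambda>y. (\<beta> * y\<^sup>2 - 1) * exp (- (\<tau> * U (y / sqrt \<tau>))))"
    unfolding eq by simp
  have "(LINT x|lborel. ?f x) = (1 / sqrt \<tau>) * (LINT y|lborel. (\<beta> * y\<^sup>2 - 1) * exp (- (\<tau> * U (y / sqrt \<tau>))))"
    using lborel_integral_real_affine[of "1 / sqrt \<tau>" ?f 0] assms unfolding eq by simp
  moreover have "(LINT x|lborel. ?f x) = - (\<tau> * G \<tau>)"
    using Wint_critical_eq[OF assms] by (simp add: Wint_def)
  ultimately show "(LINT y|lborel. (\<beta> * y\<^sup>2 - 1) * exp (- (\<tau> * U (y / sqrt \<tau>)))) = - (sqrt \<tau> * \<tau> * G \<tau>)"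
    using assms by (simp add: field_simps)
qed

text \<open>In the variable \<open>y = sqrt \<tau> * x\<close> the quadratic part of the exponent no longer depends on \<open>\<tau>\<close>,
  and the ratio of the weights for two values of \<open>\<tau>\<close> is monotone in \<open>\<bar>y\<bar>\<close>.\<close>

lemma rescaled_difference_strict_mono:
  assumes "0 < s" "s < t" "0 \<le> x" "x < y"
  shows "s * U (x / sqrt s) - t * U (x / sqrt t) < s * U (y / sqrt s) - t * U (y / sqrt t)"
proof (rule DERIV_pos_imp_increasing_open[OF assms(4)])
  fix z assume z: "x < z" "z < y"
  have deriv: "((\<lambda>z. s * U (z / sqrt s) - t * U (z / sqrt t)) has_real_derivative
      s * ((z / sqrt s) * (q (z / sqrt s) + \<beta>) * (1 / sqrt s)) - t * ((z / sqrt t) * (q (z / sqrt t) + \<beta>) * (1 / sqrt t))) (at z)"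
    by (intro DERIV_diff DERIV_cmult DERIV_chain2[OF U_deriv] DERIV_cdivide DERIV_ident)
  have cancel: "u * ((z / sqrt u) * c * (1 / sqrt u)) = z * c" if "u > 0" for u c
  proof -
    have "u * ((z / sqrt u) * c * (1 / sqrt u)) = u / (sqrt u * sqrt u) * (z * c)" by simp
    then show ?thesis using that by simp
  qed
  have "s * ((z / sqrt s) * (q (z / sqrt s) + \<beta>) * (1 / sqrt s)) = z * (q (z / sqrt s) + \<beta>)"
    "t * ((z / sqrt t) * (q (z / sqrt t) + \<beta>) * (1 / sqrt t)) = z * (q (z / sqrt t) + \<beta>)"
    by (rule cancel; use assms in simp)+
  \<comment> \<open>The \<open>\<beta> * z\<close> terms cancel, and \<open>s < t\<close> makes
    \<open>z / sqrt s\<close> the larger argument of \<open>q\<close>.\<close>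
  moreover have "z * (q (z / sqrt s) + \<beta>) - z * (q (z / sqrt t) + \<beta>) > 0"
    using assms z q_mono[of "z / sqrt t" "z / sqrt s"] by (simp add: frac_less2)
  ultimately show "\<exists>d. ((\<lambda>z. s * U (z / sqrt s) - t * U (z / sqrt t)) has_real_derivative d) (at z) \<and> d > 0"
    using deriv by metis
next
  show "continuous_on {x..y} (\<lambda>z. s * U (z / sqrt s) - t * U (z / sqrt t))"
    using assms by (intro continuous_intros continuous_on_compose2[OF U_cont[of UNIV]]) auto
qed

text \<open>The prefactor changes sign at \<open>y0\<close>, and the weight ratio
  \<open>exp (D y)\<close> increases with \<open>\<bar>y\<bar>\<close>, so subtracting
  \<open>exp (D y0)\<close> times the integrand for \<open>s\<close> leaves a nonnegative function.
  The minus sign in \<open>Wint_rescaled\<close> turns positivity into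
  \<open>G t < 0\<close>.\<close>

lemma G_neg_mono:
  assumes "0 < s" "s < t" "G s \<le> 0"
  shows "G t < 0"
proof -
  have t: "t > 0" using assms by simp
  define D where "D = (\<lambda>y. s * U (y / sqrt s) - t * U (y / sqrt t))"
  define y0 where "y0 = 1 / sqrt \<beta>"
  have y0: "y0 > 0" "\<beta> * y0\<^sup>2 = 1" using \<beta>_pos by (auto simp: y0_def power_divide)
  let ?f = "\<lambda>\<tau> y. (\<beta> * y\<^sup>2 - 1) * exp (- (\<tau> * U (y / sqrt \<tau>)))"
  have D: "D x < D y" if "0 \<le> x" "x < y" for x y
    unfolding D_def using rescaled_difference_strict_mono assms that by blast
  have D_abs: "D \<bar>y\<bar> = D y" for y
    by (cases "y \<ge> 0") (auto simp: D_def U_even simp flip: minus_divide_left)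
  have ft: "?f t y = ((\<beta> * y\<^sup>2 - 1) * exp (D y)) * exp (- (s * U (y / sqrt s)))" for y
    by (simp add: D_def mult_exp_exp mult.assoc)
  have strict: "exp (D y0) * (\<beta> * y\<^sup>2 - 1) < (\<beta> * y\<^sup>2 - 1) * exp (D y)" if "\<bar>y\<bar> \<noteq> y0" for y
  proof (cases "\<bar>y\<bar> < y0")
    case True
    have "y\<^sup>2 < y0\<^sup>2" using power_strict_mono[OF True, of 2] by simp
    then have "\<beta> * y\<^sup>2 - 1 < 0" using mult_strict_left_mono[OF _ \<beta>_pos] y0(2) by fastforce
    moreover have "exp (D y) < exp (D y0)" using D[OF _ True] D_abs by simp
    ultimately show ?thesis by (simp add: mult.commute mult_less_cancel_right)
  next
    case False
    then have gt: "y0 < \<bar>y\<bar>" using that by simp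
    have "y0\<^sup>2 < y\<^sup>2" using power_strict_mono[OF gt, of 2] y0 by simp
    then have "\<beta> * y\<^sup>2 - 1 > 0" using mult_strict_left_mono[OF _ \<beta>_pos] y0(2) by fastforce
    moreover have "exp (D y0) < exp (D y)" using D[OF _ gt] y0 D_abs by simp
    ultimately show ?thesis by (simp add: mult.commute mult_less_cancel_right)
  qed
  have le: "exp (D y0) * (\<beta> * y\<^sup>2 - 1) \<le> (\<beta> * y\<^sup>2 - 1) * exp (D y)" for y
  proof (cases "\<bar>y\<bar> = y0")
    case True
    then have "y\<^sup>2 = y0\<^sup>2" using power2_abs by metis
    then show ?thesis using y0 by simp
  qed (use strict[of y] in simp)
  have "(LINT y|lborel. ?f t y) > 0"
  proof (rule single_crossing_integral_pos[where f = "?f s" and k = "exp (D y0)" and c = 0 and d = y0])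
    show "(LINT y|lborel. ?f s y) \<ge> 0"
      using Wint_rescaled(2)[OF assms(1)] assms by (simp add: mult_nonneg_nonpos)
    show "exp (D y0) * ?f s y \<le> ?f t y" for y
      unfolding ft using mult_right_mono[OF le[of y], of "exp (- (s * U (y / sqrt s)))"] by (simp add: mult.assoc)
    show "exp (D y0) * ?f s y < ?f t y" if "0 < y" "y < y0" for y
      unfolding ft using mult_strict_right_mono[OF strict[of y], of "exp (- (s * U (y / sqrt s)))"] that
      by (simp add: mult.assoc)
  qed (use y0 Wint_rescaled(1) assms t in auto)
  then have "- (sqrt t * t * G t) > 0" using Wint_rescaled(2)[OF t] by simp
  then show ?thesis using t by (simp add: mult_less_0_iff not_less[symmetric])
qed

lemma G_cont:
  assumes "a > 0"
  shows "continuous_on {a..b} G"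
proof (cases "a \<le> b")
  case True
  show ?thesis
    unfolding G_def[abs_def] Wint_def
  proof (rule continuous_on_integral_dominated)
    let ?w = "\<lambda>\<tau> x. \<bar>x * q x * x\<bar> * exp (- (\<tau> * U x))"
    show "integrable lborel (\<lambda>x. ?w a x + ?w b x)"
      using assms True G_bounded by (intro Bochner_Integration.integrable_add integrable_weight exp_bounded_abs) auto
    show "\<bar>x * q x * x * exp (- (t * U x))\<bar> \<le> ?w a x + ?w b x" if t: "t \<in> {a..b}" for t x
    proof -
      \<comment> \<open>\<open>U\<close> may be negative, so the weight is decreasing or increasing
        in \<open>t\<close> according to the sign of \<open>U x\<close>; the sum of the endpoint
        weights covers both cases.\<close>
      have "exp (- (t * U x)) \<le> exp (- (a * U x)) + exp (- (b * U x))"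
      proof (cases "U x \<ge> 0")
        case True
        then have "exp (- (t * U x)) \<le> exp (- (a * U x))" using t by (auto intro: mult_right_mono)
        then show ?thesis using exp_gt_zero[of "- (b * U x)"] by linarith
      next
        case False
        then have "exp (- (t * U x)) \<le> exp (- (b * U x))" using t by (auto intro: mult_right_mono_neg)
        then show ?thesis using exp_gt_zero[of "- (a * U x)"] by linarith
      qed
      from mult_left_mono[OF this, of "\<bar>x * q x * x\<bar>"] show ?thesis by (simp add: abs_mult distrib_left)
    qed
    show "(\<lambda>x. x * q x * x * exp (- (t * U x))) \<in> borel_measurable borel" for t
      using exp_bounded_measurable[OF q_bounded] by measurable
  qed (intro continuous_intros)
qed auto

lemma U_strict_mono:
  assumes "0 < x" "x < y" "q x + \<beta> > 0"
  shows "U x < U y"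
proof (rule DERIV_pos_imp_increasing[OF assms(2)])
  fix z assume z: "x \<le> z" "z \<le> y"
  then have "q x \<le> q z" using q_mono[of x z] assms by (cases "x = z") auto
  then show "\<exists>d. (U has_real_derivative d) (at z) \<and> d > 0"
    using assms z by (intro exI[of _ "z * (q z + \<beta>)"] conjI U_deriv mult_pos_pos) auto
qed

lemma q_ge_q0: "q 0 \<le> q x"
  using q_mono[of 0 "\<bar>x\<bar>"] q_abs[of x] by (cases "x = 0") auto

text \<open>As \<open>\<tau>\<close> tends to 0 the weights spread out, so the region where \<open>q > 0\<close> dominates.\<close>

lemma G_pos_near_0: "\<exists>\<tau>>0. G \<tau> > 0"
proof -
  obtain C where C: "\<And>x. V x \<ge> 0 * x\<^sup>2 - C" using V_growth by blast
  have U_ge: "U x \<ge> - \<bar>C\<bar>" for x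

  proof -
    have "\<beta> / 2 * x\<^sup>2 \<ge> 0" using \<beta>_pos by simp
    then show ?thesis using C[of x] unfolding U_def by linarith
  qed
  define B where "B = r\<^sup>2 * (- q 0) * exp \<bar>C\<bar>"
  define \<kappa> where "\<kappa> = (2 * r)\<^sup>2 * q (2 * r)"
  have \<kappa>: "\<kappa> > 0" using r_pos q_pos[of "2 * r"] by (simp add: \<kappa>_def)
  have B: "B > 0" unfolding B_def using r_pos q_neg[of 0] by (intro mult_pos_pos) auto
  \<comment> \<open>For \<open>\<tau> <= 1\<close> the region \<open>\<bar>x\<bar> <= r\<close>
    costs at most \<open>2 * r * B\<close>. The window \<open>[2r, 2r + L]\<close>, with weight at
    least 1/2, gains at least \<open>\<kappa> / 2 * L\<close>. This \<open>L\<close> makes the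
    balance equal to 1.\<close>
  define L where "L = (4 * r * B + 2) / \<kappa>"
  have L: "L > 0" "L * \<kappa> = 4 * r * B + 2" using \<kappa> B r_pos by (auto simp: L_def add_pos_pos)
  obtain M where M: "\<And>x. x \<in> {2 * r..2 * r + L} \<Longrightarrow> U x \<le> M"
    using continuous_attains_sup[of "{2 * r..2 * r + L}" U] U_cont L(1) by (metis atLeastAtMost_iff compact_Icc empty_iff le_add_same_cancel1 less_imp_le order_refl)
  \<comment> \<open>Ensures \<open>\<tau> * U x <= 1 / 2\<close> on the window, hence weight at
    least 1/2 by \<open>exp u >= 1 + u\<close>; \<open>\<tau> <= 1\<close> keeps the weight below
    \<open>exp \<bar>C\<bar>\<close> near the origin.\<close>
  define \<tau> where "\<tau> = 1 / (2 * (\<bar>M\<bar> + 1))"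
  have \<tau>: "\<tau> > 0" "\<tau> \<le> 1" "\<tau> * \<bar>M\<bar> \<le> 1 / 2" by (auto simp: \<tau>_def field_simps)
  let ?lb = "\<lambda>x. - B * indicator {- r..r} x + \<kappa> / 2 * indicator {2 * r..2 * r + L} x"
  have pw: "?lb x \<le> x * q x * x * exp (- (\<tau> * U x))" for x
  proof (cases "\<bar>x\<bar> \<le> r")
    case True
    have "- (\<tau> * U x) \<le> \<tau> * \<bar>C\<bar>" using mult_left_mono[OF U_ge[of x], of \<tau>] \<tau> by simp
    also have "\<dots> \<le> \<bar>C\<bar>" using \<tau> by (simp add: mult_left_le_one_le)
    finally have e: "exp (- (\<tau> * U x)) \<le> exp \<bar>C\<bar>" by simp
    have "x\<^sup>2 \<le> r\<^sup>2" using power_mono[OF True, of 2] by simp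
    then have A: "x\<^sup>2 * (- q x) \<le> r\<^sup>2 * (- q 0)"
      using q_ge_q0[of x] q_neg[of x] q_zero[of x] True
      by (intro mult_mono) (auto simp: less_eq_real_def)
    have B: "r\<^sup>2 * (- q 0) \<ge> 0" using q_neg[of 0] r_pos by (intro mult_nonneg_nonneg) auto
    have "x\<^sup>2 * (- q x) * exp (- (\<tau> * U x)) \<le> r\<^sup>2 * (- q 0) * exp \<bar>C\<bar>"
      by (rule mult_mono[OF A e B]) simp
    then show ?thesis using True r_pos by (auto simp: B_def indicator_def power2_eq_square algebra_simps)
  next
    case False
    have qx: "q x > 0" using q_pos False by simp
    show ?thesis
    proof (cases "x \<in> {2 * r..2 * r + L}")
      case True
      have "(2 * r)\<^sup>2 \<le> x\<^sup>2" using True r_pos by (intro power_mono) auto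
      moreover have "q (2 * r) \<le> q x" using True r_pos q_mono[of "2 * r" x] by (cases "x = 2 * r") auto
      ultimately have "\<kappa> \<le> x\<^sup>2 * q x" unfolding \<kappa>_def using r_pos q_pos[of "2 * r"] by (intro mult_mono) auto
      moreover have "\<tau> * U x \<le> 1 / 2"
      proof -
        have "\<tau> * U x \<le> \<tau> * \<bar>M\<bar>" using M[OF True] \<tau> by (intro mult_left_mono) auto
        then show ?thesis using \<tau> by linarith
      qed
      then have "exp (- (\<tau> * U x)) \<ge> 1 / 2" using exp_ge_add_one_self[of "- (\<tau> * U x)"] by linarith
      ultimately have "\<kappa> * (1 / 2) \<le> x\<^sup>2 * q x * exp (- (\<tau> * U x))" using \<kappa> qx by (intro mult_mono) auto
      then show ?thesis using True False r_pos by (auto simp: indicator_def power2_eq_square algebra_simps)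
    next
      case F: False
      have "x\<^sup>2 * q x * exp (- (\<tau> * U x)) \<ge> 0" using qx by simp
      then show ?thesis using False F by (auto simp: indicator_def power2_eq_square algebra_simps)
    qed
  qed
  have int: "integrable lborel ?lb"
    by (intro Bochner_Integration.integrable_add integrable_mult_right integrable_real_indicator) (auto simp: emeasure_lborel_Icc_eq)
  have "(LINT x|lborel. ?lb x) = - B * (2 * r) + \<kappa> / 2 * L"
    using r_pos L by (subst Bochner_Integration.integral_add) (auto intro!: integrable_mult_right integrable_real_indicator)
  also have "\<dots> > 0" using L B r_pos by (simp add: algebra_simps)
  finally have "0 < (LINT x|lborel. ?lb x)" .
  also have "\<dots> \<le> G \<tau>"
    unfolding G_def Wint_def using int pw \<tau> G_bounded by (intro integral_mono integrable_weight) auto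
  finally show ?thesis using \<tau> by blast
qed

text \<open>As \<open>\<tau>\<close> tends to infinity the weights concentrate near the minima of \<open>U\<close>, which are
  strictly closer to the origin than those of \<open>V\<close>; there \<open>q < 0\<close>.\<close>

lemma G_neg_at_infinity: "\<exists>\<tau>>0. G \<tau> < 0"
proof -
  \<comment> \<open>At \<open>r\<close> the derivative of \<open>U\<close> is already positive,
    because \<open>q r + \<beta> = \<beta>\<close>. Continuity carries this to some
    \<open>c < r\<close>, so \<open>U\<close> drops below \<open>U r\<close> inside the region where
    \<open>q\<close> is negative.\<close>
  have "\<exists>c. 0 < c \<and> c < r \<and> q c + \<beta> > 0"
  proof -
    have "isCont q r" using q_cont by (simp add: continuous_on_eq_continuous_at)
    then obtain e where e: "e > 0" "\<And>x. \<bar>x - r\<bar> < e \<Longrightarrow> \<bar>q x - q r\<bar> < \<beta>"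
      using \<beta>_pos unfolding continuous_at_eps_delta dist_real_def by blast
    define c where "c = max (r / 2) (r - e / 2)"
    have "0 < c" "c < r" "\<bar>c - r\<bar> < e" using e(1) r_pos by (auto simp: c_def max_def)
    with e(2)[of c] q_r show ?thesis by (intro exI[of _ c]) auto
  qed
  then obtain c where c: "0 < c" "c < r" "q c + \<beta> > 0" by blast
  \<comment> \<open>Stopping at \<open>d < r\<close> keeps both \<open>q x\<close> and the gap
    \<open>U r - U x\<close> away from 0 on \<open>[c, d]\<close>.\<close>
  define d where "d = (c + r) / 2"
  have d: "c < d" "d < r" using c by (auto simp: d_def)
  have qd: "q d < 0" "q d + \<beta> > 0" using q_neg[of d] q_mono[of c d] c d by auto
  define \<eta> where "\<eta> = U r - U d"
  have \<eta>: "\<eta> > 0" using U_strict_mono[of d r] c d qd by (simp add: \<eta>_def)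
  define \<kappa> where "\<kappa> = c\<^sup>2 * (- q d) * \<eta>"
  have \<kappa>: "\<kappa> > 0" unfolding \<kappa>_def using c qd \<eta> by (intro mult_pos_pos) auto
  \<comment> \<open>\<open>n\<close> carries the weight at inverse temperature 1, scaled to be 1 at
    \<open>r\<close>. It dominates the positive part for every \<open>\<tau> >= 1\<close>, since
    \<open>U r <= U x\<close> wherever \<open>q x >= 0\<close>.\<close>
  define n where "n = (\<lambda>x. (exp (U r) * \<bar>x * q x * x\<bar>) * exp (- (1 * U x)))"
  have n: "integrable lborel n"
    unfolding n_def by (intro integrable_weight exp_bounded_mult[OF _ exp_bounded_abs[OF G_bounded]]) auto
  \<comment> \<open>After scaling by \<open>exp (\<tau> * U r)\<close> the positive part stays below
    the integral of \<open>n\<close>, while \<open>exp u >= u\<close> makes the negative part on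
    \<open>[c, d]\<close> at least \<open>\<tau> * \<kappa> * (d - c)\<close> in size.\<close>
  define \<tau> where "\<tau> = 1 + \<bar>integral\<^sup>L lborel n\<bar> / (\<kappa> * (d - c))"
  have \<tau>: "\<tau> \<ge> 1" "\<tau> * (\<kappa> * (d - c)) > integral\<^sup>L lborel n"
  proof -
    have p: "\<kappa> * (d - c) > 0" using \<kappa> d by simp
    then show "\<tau> \<ge> 1" by (simp add: \<tau>_def)
    have "\<tau> * (\<kappa> * (d - c)) = \<kappa> * (d - c) + \<bar>integral\<^sup>L lborel n\<bar>" 
      using less_imp_neq[OF p] unfolding \<tau>_def distrib_right by simp
    with p show "\<tau> * (\<kappa> * (d - c)) > integral\<^sup>L lborel n" by linarith
  qed
  have pw: "exp (\<tau> * U r) * (x * q x * x * exp (- (\<tau> * U x))) \<le> n x - \<tau> * \<kappa> * indicator {c..d} x" for x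
  proof -
    have eq: "exp (\<tau> * U r) * (x * q x * x * exp (- (\<tau> * U x))) = x\<^sup>2 * q x * exp (\<tau> * (U r - U x))"
      by (simp add: right_diff_distrib exp_diff exp_minus power2_eq_square field_simps)
    have n_eq: "n x = x\<^sup>2 * \<bar>q x\<bar> * exp (U r - U x)"
      by (simp add: n_def exp_diff exp_minus power2_eq_square abs_mult field_simps)
    show ?thesis
    proof (cases "\<bar>x\<bar> < r")
      case False
      have "U r \<le> U \<bar>x\<bar>" using U_strict_mono[of r "\<bar>x\<bar>"] False r_pos q_r \<beta>_pos by (cases "\<bar>x\<bar> = r") auto
      then have Ux: "U r - U x \<le> 0" using U_even[of x] by (cases "x \<ge> 0") auto
      then have "\<tau> * (U r - U x) \<le> 1 * (U r - U x)" using \<tau> by (intro mult_right_mono_neg) auto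
      moreover have "q x \<ge> 0" using q_pos[of x] q_zero[of x] False by (cases "\<bar>x\<bar> = r") auto
      ultimately have "x\<^sup>2 * q x * exp (\<tau> * (U r - U x)) \<le> x\<^sup>2 * \<bar>q x\<bar> * exp (U r - U x)"
        by (intro mult_mono) auto
      moreover have "x \<notin> {c..d}" using False c d by auto
      ultimately show ?thesis unfolding eq n_eq by simp
    next
      case True
      have qx: "q x < 0" using q_neg[OF True] .
      have n_ge: "n x \<ge> 0" by (simp add: n_def)
      show ?thesis
      proof (cases "x \<in> {c..d}")
        case True
        have "U x \<le> U d"
        proof (cases "x = d")
          case False
          have "q c \<le> q x" using q_mono[of c x] True c by (cases "x = c") auto
          then show ?thesis using U_strict_mono[of x d] False True c by auto
        qed simp
        then have "\<eta> \<le> U r - U x" by (simp add: \<eta>_def)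
        then have "\<tau> * \<eta> \<le> \<tau> * (U r - U x)" using \<tau> by (intro mult_left_mono) auto
        then have e: "\<tau> * \<eta> \<le> exp (\<tau> * (U r - U x))"
          using exp_ge_add_one_self[of "\<tau> * (U r - U x)"] by linarith
        have "c\<^sup>2 \<le> x\<^sup>2" using True c by (intro power_mono) auto
        moreover have "- q d \<le> - q x" using q_mono[of x d] True c by (cases "x = d") auto
        ultimately have A: "c\<^sup>2 * (- q d) \<le> x\<^sup>2 * (- q x)" using qd by (intro mult_mono) auto
        have "c\<^sup>2 * (- q d) * (\<tau> * \<eta>) \<le> x\<^sup>2 * (- q x) * exp (\<tau> * (U r - U x))"
          by (rule mult_mono[OF A e]) (use \<eta> \<tau> qx in \<open>simp_all add: mult_nonneg_nonpos\<close>)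
        then show ?thesis using n_ge True unfolding eq by (simp add: \<kappa>_def algebra_simps)
      next
        case False
        moreover have "x\<^sup>2 * q x * exp (\<tau> * (U r - U x)) \<le> 0"
          using qx by (intro mult_nonpos_nonneg mult_nonneg_nonpos) auto
        ultimately show ?thesis using n_ge unfolding eq by simp
      qed
    qed
  qed
  have "exp (\<tau> * U r) * G \<tau> = (LINT x|lborel. exp (\<tau> * U r) * (x * q x * x * exp (- (\<tau> * U x))))"
    by (simp add: G_def Wint_def)
  also have "\<dots> \<le> (LINT x|lborel. n x - \<tau> * \<kappa> * indicator {c..d} x)"
    using pw n \<tau> G_bounded
    by (intro integral_mono integrable_mult_right integrable_weight Bochner_Integration.integrable_diff integrable_real_indicator) (auto simp: emeasure_lborel_Icc_eq)
  also have "\<dots> = integral\<^sup>L lborel n - \<tau> * \<kappa> * (d - c)"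
    using n d by (subst Bochner_Integration.integral_diff) (auto intro!: integrable_mult_right integrable_real_indicator)
  also have "\<dots> < 0" using \<tau>(2) by (simp add: mult.assoc)
  finally have "G \<tau> < 0" by (simp add: mult_less_0_iff)
  then show ?thesis using \<tau> by (intro exI[of _ \<tau>]) auto
qed

text \<open>A nonpositive value of \<open>G\<close> forces negative values at every larger \<tau>,
  so a zero is unique and separates the signs. The two limiting regimes and continuity supply
  one.\<close>

lemma critical_inverse_temperature:
  obtains \<tau>\<^sub>c where "\<tau>\<^sub>c > 0" "\<And>\<tau>. \<tau> > 0 \<Longrightarrow> G \<tau> = 0 \<longleftrightarrow> \<tau> = \<tau>\<^sub>c" "\<And>\<tau>. \<tau> > 0 \<Longrightarrow> G \<tau> < 0 \<longleftrightarrow> \<tau> > \<tau>\<^sub>c"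
proof -
  obtain s where s: "s > 0" "G s > 0" using G_pos_near_0 by blast
  obtain t where t: "t > 0" "G t < 0" using G_neg_at_infinity by blast
  have "s < t" using G_neg_mono[of t s] s t by (cases s t rule: linorder_cases) auto
  then obtain u where u: "s \<le> u" "u \<le> t" "G u = 0"
    using IVT2'[of G t 0 s] s t G_cont[of s t] by auto
  have "G \<tau> > 0" if "\<tau> > 0" "\<tau> < u" for \<tau>
    using G_neg_mono[of \<tau> u] that u by (cases "G \<tau> \<le> 0") auto
  moreover have "G \<tau> < 0" if "\<tau> > u" for \<tau>
    using G_neg_mono[of u \<tau>] that u s by auto
  ultimately show ?thesis
    using u s by (intro that[of u]) (auto, (metis less_irrefl linorder_neqE_linordered_idom not_less_iff_gr_or_eq)+)
qed

subsection \<open>Gibbs measures\<close>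

lemma gibbs_weight_eq: "gibbs_weight U \<sigma> A x = exp ((2 / \<sigma>\<^sup>2 * A) * x) * exp (- (2 / \<sigma>\<^sup>2 * U x))"
proof -
  have "- (2 / \<sigma>\<^sup>2) * (U x - A * x) = (2 / \<sigma>\<^sup>2 * A) * x + - (2 / \<sigma>\<^sup>2 * U x)"
    unfolding right_diff_distrib by simp
  then show ?thesis unfolding gibbs_weight_def exp_add[symmetric] by simp
qed

lemma gibbs_weight_pos: "gibbs_weight U \<sigma> A x > 0"
  by (simp add: gibbs_weight_def)

lemma integrable_gibbs_weight:
  assumes "\<sigma> > 0" "exp_bounded f"
  shows "integrable lborel (\<lambda>x. f x * gibbs_weight U \<sigma> A x)"
  unfolding gibbs_weight_eq mult.assoc[symmetric, of "f _"]
  using assms by (intro integrable_weight exp_bounded_mult exp_bounded_exp) auto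

definition Z :: "real \<Rightarrow> real \<Rightarrow> real" where
  "Z \<sigma> A = (LINT x|lborel. gibbs_weight U \<sigma> A x)"

lemma Z_eq: "Z \<sigma> A = Wint (2 / \<sigma>\<^sup>2) (\<lambda>x. exp ((2 / \<sigma>\<^sup>2 * A) * x))"
  by (simp add: Z_def Wint_def gibbs_weight_eq)

lemma Z_pos: "\<sigma> > 0 \<Longrightarrow> Z \<sigma> A > 0"
  unfolding Z_eq by (intro Wint_pos exp_bounded_exp) auto

text \<open>By parts with the exponential tilt as \<open>f\<close>: its derivative yields
  \<open>A * Z \<sigma> A\<close>, and the term \<open>\<beta> * x\<close> of \<open>U'\<close>
  yields \<beta> times the first moment. \<open>K\<close> is thus the defect in the self-consistency
  equation.\<close>

lemma self_consistent_iff_K: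
  assumes "\<sigma> > 0"
  shows "self_consistent U \<beta> \<sigma> A \<longleftrightarrow> K (2 / \<sigma>\<^sup>2) (2 / \<sigma>\<^sup>2 * A) = 0"
proof -
  define \<tau> where "\<tau> = 2 / \<sigma>\<^sup>2"
  have \<tau>: "\<tau> > 0" using assms by (simp add: \<tau>_def)
  let ?e = "\<lambda>x. exp ((\<tau> * A) * x)"
  have Z: "Z \<sigma> A > 0" "Z \<sigma> A = Wint \<tau> ?e" using Z_pos[OF assms] Z_eq by (auto simp: \<tau>_def)
  have m: "(LINT x|lborel. x * gibbs_weight U \<sigma> A x) = Wint \<tau> (\<lambda>x. x * ?e x)"
    by (simp add: Wint_def gibbs_weight_eq \<tau>_def mult.assoc)
  have bm: "exp_bounded (\<lambda>x. x * ?e x)" by (intro exp_bounded_mult) auto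
  have "Wint \<tau> (\<lambda>x. ?e x * (x * (q x + \<beta>))) = Wint \<tau> (\<lambda>x. x * q x * ?e x + \<beta> * (x * ?e x))"
    by (simp add: algebra_simps)
  also have "\<dots> = K \<tau> (\<tau> * A) + \<beta> * Wint \<tau> (\<lambda>x. x * ?e x)"
    using \<tau> K_bounded bm by (subst Wint_add) (auto simp: K_def Wint_cmult)
  finally have "Wint \<tau> (\<lambda>x. (\<tau> * A) * ?e x) = \<tau> * (K \<tau> (\<tau> * A) + \<beta> * Wint \<tau> (\<lambda>x. x * ?e x))"
    using \<tau> by (subst Wint_by_parts[where f = ?e])
      (auto intro!: exp_bounded_mult continuous_intros derivative_eq_intros)
  then have "A * Z \<sigma> A = K \<tau> (\<tau> * A) + \<beta> * Wint \<tau> (\<lambda>x. x * ?e x)"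
    using \<tau> by (simp add: Wint_cmult Z(2))
  then have "K \<tau> (\<tau> * A) = 0 \<longleftrightarrow> A * Z \<sigma> A = \<beta> * Wint \<tau> (\<lambda>x. x * ?e x)" by auto
  also have "\<dots> \<longleftrightarrow> A / \<beta> = Wint \<tau> (\<lambda>x. x * ?e x) / Z \<sigma> A"
    using Z(1) \<beta>_pos by (auto simp: field_simps)
  finally show ?thesis by (simp add: self_consistent_def m Z_def \<tau>_def)
qed

lemma critical_equation_iff_G:
  assumes "\<sigma> > 0"
  shows "critical_equation U \<beta> \<sigma> \<longleftrightarrow> G (2 / \<sigma>\<^sup>2) = 0"
proof -
  define \<tau> where "\<tau> = 2 / \<sigma>\<^sup>2"
  have \<tau>: "\<tau> > 0" "\<sigma>\<^sup>2 / (2 * \<beta>) = 1 / (\<beta> * \<tau>)" using assms by (auto simp: \<tau>_def)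
  have "Wint \<tau> (\<lambda>x. 1) > 0" using \<tau> by (intro Wint_pos) auto
  moreover have "Wint \<tau> (\<lambda>x. \<beta> * \<tau> * x\<^sup>2 - 1) = \<beta> * \<tau> * Wint \<tau> (\<lambda>x. x\<^sup>2) - Wint \<tau> (\<lambda>x. 1)"
    using \<tau> by (subst Wint_diff) (auto simp: Wint_cmult)
  ultimately have "Wint \<tau> (\<lambda>x. x\<^sup>2) / Wint \<tau> (\<lambda>x. 1) = 1 / (\<beta> * \<tau>) \<longleftrightarrow> G \<tau> = 0"
    using Wint_critical_eq[OF \<tau>(1)] \<tau> \<beta>_pos by (auto simp: field_simps)
  then show ?thesis
    unfolding critical_equation_def \<tau>(2) by (simp add: Wint_def \<tau>_def)
qed

text \<open>The passage from \<tau> to \<sigma> reverses order: large \<tau> is small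
  diffusion.\<close>

lemma critical_diffusion:
  obtains \<sigma>\<^sub>c where "\<sigma>\<^sub>c > 0" "\<And>\<sigma>. \<sigma> > 0 \<Longrightarrow> critical_equation U \<beta> \<sigma> \<longleftrightarrow> \<sigma> = \<sigma>\<^sub>c"
    "\<And>\<sigma>. \<sigma> > 0 \<Longrightarrow> G (2 / \<sigma>\<^sup>2) < 0 \<longleftrightarrow> \<sigma> < \<sigma>\<^sub>c"
proof -
  obtain \<tau>\<^sub>c where \<tau>\<^sub>c: "\<tau>\<^sub>c > 0" "\<And>\<tau>. \<tau> > 0 \<Longrightarrow> G \<tau> = 0 \<longleftrightarrow> \<tau> = \<tau>\<^sub>c"
    "\<And>\<tau>. \<tau> > 0 \<Longrightarrow> G \<tau> < 0 \<longleftrightarrow> \<tau> > \<tau>\<^sub>c"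
    using critical_inverse_temperature by blast
  define \<sigma>\<^sub>c where "\<sigma>\<^sub>c = sqrt (2 / \<tau>\<^sub>c)"
  have \<sigma>\<^sub>c: "\<sigma>\<^sub>c > 0" "\<tau>\<^sub>c = 2 / \<sigma>\<^sub>c\<^sup>2" using \<tau>\<^sub>c(1) by (auto simp: \<sigma>\<^sub>c_def)
  show ?thesis
  proof (rule that[OF \<sigma>\<^sub>c(1)])
    fix \<sigma> :: real assume \<sigma>: "\<sigma> > 0"
    then have "2 / \<sigma>\<^sup>2 > 0" by simp
    note * = \<tau>\<^sub>c(2,3)[OF this]
    have "2 / \<sigma>\<^sup>2 = 2 / \<sigma>\<^sub>c\<^sup>2 \<longleftrightarrow> \<sigma> = \<sigma>\<^sub>c" using \<sigma> \<sigma>\<^sub>c(1) by (auto simp: field_simps)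
    then show "critical_equation U \<beta> \<sigma> \<longleftrightarrow> \<sigma> = \<sigma>\<^sub>c"
      using * by (simp add: critical_equation_iff_G[OF \<sigma>] \<sigma>\<^sub>c(2))
    have "2 / \<sigma>\<^sup>2 > 2 / \<sigma>\<^sub>c\<^sup>2 \<longleftrightarrow> \<sigma>\<^sup>2 < \<sigma>\<^sub>c\<^sup>2" using \<sigma> \<sigma>\<^sub>c(1) by (simp add: field_simps)
    also have "\<dots> \<longleftrightarrow> \<sigma> < \<sigma>\<^sub>c" using \<sigma> \<sigma>\<^sub>c(1) by (meson less_imp_le power2_less_imp_less power_strict_mono zero_less_numeral)
    finally show "G (2 / \<sigma>\<^sup>2) < 0 \<longleftrightarrow> \<sigma> < \<sigma>\<^sub>c" using * by (simp add: \<sigma>\<^sub>c(2))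
  qed
qed

section \<open>Moments and normalization of the tilted measures\<close>

lemma gibbs_weight_measurable [measurable]: "gibbs_weight U \<sigma> A \<in> borel_measurable borel"
  unfolding gibbs_weight_def[abs_def] by measurable

lemma integrable_gibbs_measure:
  assumes "\<sigma> > 0" "exp_bounded f"
  shows "integrable (gibbs_measure U \<sigma> A) f"
    and "(LINT x|gibbs_measure U \<sigma> A. f x) = (LINT x|lborel. f x * gibbs_weight U \<sigma> A x) / Z \<sigma> A"
proof -
  have f: "f \<in> borel_measurable borel" using exp_bounded_measurable assms(2) .
  have nn: "gibbs_weight U \<sigma> A x / Z \<sigma> A \<ge> 0" for x
    using gibbs_weight_pos Z_pos[OF assms(1)] by (simp add: less_imp_le)
  have eq: "gibbs_weight U \<sigma> A x / Z \<sigma> A * f x = (1 / Z \<sigma> A) * (f x * gibbs_weight U \<sigma> A x)" for x by simp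
  show "integrable (gibbs_measure U \<sigma> A) f"
    unfolding gibbs_measure_def Z_def[symmetric]
    using f nn integrable_gibbs_weight[OF assms]
    by (subst integrable_density) (simp_all add: eq del: times_divide_eq_left times_divide_eq_right)
  show "(LINT x|gibbs_measure U \<sigma> A. f x) = (LINT x|lborel. f x * gibbs_weight U \<sigma> A x) / Z \<sigma> A"
    unfolding gibbs_measure_def Z_def[symmetric]
    using f nn
    by (subst integral_density) (simp_all only: eq real_scaleR_def integral_mult_right_zero, simp_all)
qed

text \<open>Total mass one fixes the constant, so the factor that second moments put into a
  stationary density can stay unevaluated.\<close>

lemma density_normalization:
  assumes "\<sigma> > 0" "c > 0" and "prob_space (density lborel (\<lambda>x. ennreal (gibbs_weight U \<sigma> A x * c)))"
  shows "c = 1 / Z \<sigma> A"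
proof -
  interpret prob_space "density lborel (\<lambda>x. ennreal (gibbs_weight U \<sigma> A x * c))" by fact
  have "1 = (\<integral>\<^sup>+x. ennreal (gibbs_weight U \<sigma> A x * c) \<partial>lborel)"
    using emeasure_space_1 by (subst (asm) emeasure_density) auto
  also have "\<dots> = ennreal (LINT x|lborel. gibbs_weight U \<sigma> A x * c)"
    using integrable_gibbs_weight[OF assms(1), of "\<lambda>x. c"] assms gibbs_weight_pos
    by (intro nn_integral_eq_integral) (auto simp: mult.commute less_imp_le)
  also have "\<dots> = ennreal (Z \<sigma> A * c)" by (simp add: Z_def)
  finally have "Z \<sigma> A * c = 1" using Z_pos[OF assms(1)] assms(2) by (simp add: ennreal_eq_1)
  then show ?thesis using Z_pos[OF assms(1), of A] by (simp add: field_simps)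
qed

lemma prob_space_gibbs_measure:
  assumes "\<sigma> > 0"
  shows "prob_space (gibbs_measure U \<sigma> A)"
proof
  have "emeasure (gibbs_measure U \<sigma> A) (space (gibbs_measure U \<sigma> A)) =
      (\<integral>\<^sup>+x. ennreal (gibbs_weight U \<sigma> A x / Z \<sigma> A) \<partial>lborel)"
    unfolding gibbs_measure_def Z_def[symmetric] by (subst emeasure_density) auto
  also have "\<dots> = ennreal (LINT x|lborel. gibbs_weight U \<sigma> A x / Z \<sigma> A)"
    using integrable_gibbs_weight[OF assms, of "\<lambda>x. 1 / Z \<sigma> A"] Z_pos[OF assms] gibbs_weight_pos
    by (intro nn_integral_eq_integral) (auto simp: less_imp_le)
  also have "\<dots> = 1" using Z_pos[OF assms, of A] by (simp add: Z_def)
  finally show "emeasure (gibbs_measure U \<sigma> A) (space (gibbs_measure U \<sigma> A)) = 1" .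
qed

lemma self_consistent_iff_mean:
  assumes "\<sigma> > 0"
  shows "self_consistent U \<beta> \<sigma> A \<longleftrightarrow> A = \<beta> * (LINT y|gibbs_measure U \<sigma> A. y)"
  using integrable_gibbs_measure(2)[OF assms exp_bounded_ident, of A] \<beta>_pos
  by (auto simp: self_consistent_def Z_def field_simps)

text \<open>The tilt is recovered from the measure as \<beta> times its mean, so distinct tilts give
  distinct tuples and counting states amounts to counting tilts. \<open>1 <= M\<close> provides a
  component to read it from.\<close>

lemma associated_state_unique:
  assumes "\<sigma> > 0" "1 \<le> M" "associated_state M U \<beta> \<sigma> A \<mu>" "associated_state M U \<beta> \<sigma> B \<mu>"
  shows "A = B"
proof -
  have "gibbs_measure U \<sigma> A = \<mu> 1" "gibbs_measure U \<sigma> B = \<mu> 1"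
    using assms(2-4) by (metis associated_state_def restrict_apply' atLeastAtMost_iff order_refl)+
  then show ?thesis
    using assms self_consistent_iff_mean by (metis associated_state_def)
qed

end

section \<open>Quadratic interactions: only the first two moments of a measure enter\<close>

lemma convolution_measure_quadratic:
  assumes "prob_space \<mu>" "integrable \<mu> (\<lambda>y. y)" "integrable \<mu> (\<lambda>y. y\<^sup>2)"
  shows "convolution_measure (\<lambda>x. c / 2 * x\<^sup>2) \<mu> x =
    c / 2 * (x\<^sup>2 - 2 * x * (LINT y|\<mu>. y) + (LINT y|\<mu>. y\<^sup>2))"
proof -
  interpret prob_space \<mu> by fact
  have "(x - y)\<^sup>2 = x\<^sup>2 - 2 * x * y + y\<^sup>2" for y
    by (simp add: power2_diff)
  then have "convolution_measure (\<lambda>x. c / 2 * x\<^sup>2) \<mu> x = (LINT y|\<mu>. c / 2 * (x\<^sup>2 - 2 * x * y + y\<^sup>2))"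
    by (simp only: convolution_measure_def)
  also have "\<dots> = c / 2 * (x\<^sup>2 - 2 * x * (LINT y|\<mu>. y) + (LINT y|\<mu>. y\<^sup>2))"
    using assms by (simp add: prob_space)
  finally show ?thesis .
qed

lemma integrable_ident_if_square:
  fixes M :: "real measure"
  assumes "prob_space M" "sets M = sets borel" "integrable M (\<lambda>y. y\<^sup>2)"
  shows "integrable M (\<lambda>y. y)"
proof -
  interpret prob_space M by fact
  have "integrable M (\<lambda>y. 1 + y\<^sup>2)" using assms by simp
  moreover have "(\<lambda>y. y) \<in> borel_measurable M" using assms(2) by (simp add: measurable_def sets_eq_imp_space_eq)
  moreover have "\<bar>y\<bar> \<le> 1 + y\<^sup>2" for y :: real
    using sum_squares_bound[of 1 "\<bar>y\<bar>"] by simp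
  ultimately show ?thesis
    by (elim Bochner_Integration.integrable_bound) (auto intro!: AE_I2 order.trans[OF _ abs_ge_self])
qed

subsection \<open>Stationary states\<close>

lemma confining_potential_scale:
  assumes "confining_potential W" "c > 0" "\<And>x. V x = c * W x"
  shows "confining_potential V"
proof -
  obtain p \<theta> where p: "2 \<le> (p::nat)" "\<theta> 2 > (0::real)" "\<theta> (2 * p) > 0"
    "\<forall>i\<in>{2..p - 1}. \<theta> (2 * i) \<ge> 0"
    "\<And>x. W x = - (\<theta> 2 / 2) * x ^ 2 + (\<Sum>l = 2..p. \<theta> (2 * l) / (2 * real l) * x ^ (2 * l))"
    using assms(1) unfolding confining_potential_def by blast
  have "V x = - (c * \<theta> 2 / 2) * x ^ 2 + (\<Sum>l = 2..p. c * \<theta> (2 * l) / (2 * real l) * x ^ (2 * l))" for x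
    unfolding assms(3) p(5) distrib_left sum_distrib_left by (simp add: mult.assoc)
  then show ?thesis unfolding confining_potential_def
    using p(1-4) assms(2) by (intro exI[of _ p] exI[of _ "\<lambda>i. c * \<theta> i"]) simp
qed

text \<open>\<open>q\<close> is \<open>V' x / x\<close>, a polynomial in \<open>x\<^sup>2\<close>.
  Nonnegative higher coefficients with a positive top one make it strictly increasing on the
  positive axis; it starts at \<open>- \<theta> 2 < 0\<close> and reaches a nonnegative value, which
  yields \<open>r\<close>.\<close>

lemma confining_potential_double_well:
  assumes "confining_potential V" "\<beta> > 0"
  obtains q r where "double_well V q r \<beta>"
proof -
  obtain p \<theta> where p: "2 \<le> (p::nat)" "\<theta> 2 > (0::real)" "\<theta> (2 * p) > 0"
    "\<forall>i\<in>{2..p - 1}. \<theta> (2 * i) \<ge> 0"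
    and V: "\<And>x. V x = - (\<theta> 2 / 2) * x ^ 2 + (\<Sum>l = 2..p. \<theta> (2 * l) / (2 * real l) * x ^ (2 * l))"
    using assms(1) unfolding confining_potential_def by blast
  have \<theta>: "\<theta> (2 * l) \<ge> 0" if "l \<in> {2..p}" for l
    using that p(3,4) by (cases "l = p") (auto simp: less_imp_le)
  define q where "q = (\<lambda>x. - \<theta> 2 + (\<Sum>l = 2..p. \<theta> (2 * l) * x ^ (2 * (l - 1))))"
  have q_mono: "q x < q y" if "0 \<le> x" "x < y" for x y
  proof -
    have "(\<Sum>l = 2..p. \<theta> (2 * l) * x ^ (2 * (l - 1))) < (\<Sum>l = 2..p. \<theta> (2 * l) * y ^ (2 * (l - 1)))"
    proof (rule sum_strict_mono_ex1)
      show "\<forall>l\<in>{2..p}. \<theta> (2 * l) * x ^ (2 * (l - 1)) \<le> \<theta> (2 * l) * y ^ (2 * (l - 1))"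
        using \<theta> that by (auto intro!: mult_left_mono power_mono)
      show "\<exists>l\<in>{2..p}. \<theta> (2 * l) * x ^ (2 * (l - 1)) < \<theta> (2 * l) * y ^ (2 * (l - 1))"
        using p that by (intro bexI[of _ p] mult_strict_left_mono power_strict_mono) auto
    qed simp
    then show ?thesis by (simp add: q_def)
  qed
  have q0: "q 0 < 0"
  proof -
    have "(\<Sum>l = 2..p. \<theta> (2 * l) * 0 ^ (2 * (l - 1))) = 0"
      by (intro sum.neutral) (auto simp: power_0_left)
    then show ?thesis using p(2) by (simp add: q_def)
  qed
  have q_cont: "continuous_on UNIV q" unfolding q_def by (intro continuous_intros)
  have "\<exists>R\<ge>0. q R \<ge> 0"
  proof -
    \<comment> \<open>Large enough for the top term alone to reach \<open>\<theta> 2\<close>;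
      \<open>R >= 1\<close> bounds the power below by \<open>R\<close> itself.\<close>
    define R where "R = \<theta> 2 / \<theta> (2 * p) + 1"
    have R: "R \<ge> 1" "\<theta> (2 * p) * R \<ge> \<theta> 2" using p by (auto simp: R_def field_simps)
    have "\<theta> (2 * p) * R \<le> \<theta> (2 * p) * R ^ (2 * (p - 1))"
      using p R self_le_power[of R "2 * (p - 1)"] by (intro mult_left_mono) auto
    also have "\<dots> \<le> (\<Sum>l = 2..p. \<theta> (2 * l) * R ^ (2 * (l - 1)))"
      using p R \<theta> by (intro member_le_sum[where f = "\<lambda>l. \<theta> (2 * l) * R ^ (2 * (l - 1))"]) auto
    finally have "q R \<ge> 0" using R by (simp add: q_def)
    then show ?thesis using R by (intro exI[of _ R]) auto
  qed
  then obtain R where R: "R \<ge> 0" "q R \<ge> 0" by blast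
  then obtain r where r: "0 \<le> r" "q r = 0"
    using IVT'[of q 0 0 R] q0 continuous_on_subset[OF q_cont] by (metis less_imp_le subset_UNIV)
  have "double_well V q r \<beta>"
  proof
    show "\<beta> > 0" by fact
    show "V (- x) = V x" for x by (simp add: V)
    show "q (- x) = q x" for x by (simp add: q_def)
    show "continuous_on UNIV q" by fact
    show "q x < q y" if "0 \<le> x" "x < y" for x y using q_mono that .
    show "q r = 0" by fact
    show "r > 0" using r q0 by (cases "r = 0") auto
    show "exp_bounded q"
      unfolding q_def by (intro exp_bounded_add exp_bounded_sum exp_bounded_mult) auto
    show "(V has_real_derivative x * q x) (at x)" for x
    proof -
      have "((\<lambda>x. - (\<theta> 2 / 2) * x ^ 2 + (\<Sum>l = 2..p. \<theta> (2 * l) / (2 * real l) * x ^ (2 * l))) has_real_derivative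
        - \<theta> 2 * x + (\<Sum>l = 2..p. \<theta> (2 * l) * x ^ (2 * l - 1))) (at x)"
        by (auto intro!: derivative_eq_intros DERIV_sum sum.cong simp: field_simps)
      moreover have "(\<Sum>l = 2..p. \<theta> (2 * l) * x ^ (2 * l - 1)) = (\<Sum>l = 2..p. x * (\<theta> (2 * l) * x ^ (2 * (l - 1))))"
      proof (rule sum.cong)
        fix l assume "l \<in> {2..p}"
        then have "2 * l - 1 = Suc (2 * (l - 1))" by auto
        then show "\<theta> (2 * l) * x ^ (2 * l - 1) = x * (\<theta> (2 * l) * x ^ (2 * (l - 1)))" by simp
      qed simp
      ultimately show ?thesis
        unfolding V[abs_def] q_def distrib_left sum_distrib_left by (simp add: mult.commute[of x "\<theta> 2"])
    qed
    show "\<exists>C. \<forall>x. V x \<ge> K * x\<^sup>2 - C" for K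
    proof -
      define e where "e = \<theta> (2 * p) / (2 * real p)"
      have e: "e > 0" using p by (simp add: e_def)
      \<comment> \<open>\<open>D\<close> lets the top coefficient beat both \<open>K\<close> and the
        negative quadratic term. The power is then compared with
        \<open>D * x\<^sup>2 - D\<^sup>2\<close>, which is at most 0 unless
        \<open>x\<^sup>2 >= D\<close>.\<close>
      define D where "D = 1 + (\<bar>K\<bar> + \<theta> 2 / 2) / e"
      have D: "D \<ge> 1" "e * D \<ge> \<bar>K\<bar> + \<theta> 2 / 2" using e p by (auto simp: D_def field_simps)
      have "V x \<ge> K * x\<^sup>2 - e * D\<^sup>2" for x
      proof -
        have "D * x\<^sup>2 - D\<^sup>2 \<le> x ^ (2 * p)"
        proof (cases "x\<^sup>2 \<ge> D")
          case True
          have "D * x\<^sup>2 \<le> D ^ (p - 1) * x\<^sup>2"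
            using D p self_le_power[of D "p - 1"] by (intro mult_right_mono) auto
          also have "\<dots> \<le> (x\<^sup>2) ^ (p - 1) * x\<^sup>2"
            using True D by (intro mult_right_mono power_mono) auto
          also have "\<dots> = x ^ (2 * p)"
            using p power_minus_mult[of p "x\<^sup>2"] by (simp add: power_mult)
          finally show ?thesis using zero_le_power2[of D] by linarith
        next
          case False
          then have "D * x\<^sup>2 \<le> D * D" using D by (intro mult_left_mono) auto
          then have "D * x\<^sup>2 - D\<^sup>2 \<le> 0" by (simp add: power2_eq_square)
          moreover have "x ^ (2 * p) \<ge> 0" by simp
          ultimately show ?thesis by linarith
        qed
        from mult_left_mono[OF this, of e] e
        have "e * x ^ (2 * p) \<ge> (e * D) * x\<^sup>2 - e * D\<^sup>2" by (simp add: algebra_simps)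
        moreover have "(e * D) * x\<^sup>2 \<ge> (\<bar>K\<bar> + \<theta> 2 / 2) * x\<^sup>2" using D by (intro mult_right_mono) auto
        moreover have "\<bar>K\<bar> * x\<^sup>2 \<ge> K * x\<^sup>2" by (intro mult_right_mono) auto
        moreover have "e * x ^ (2 * p) \<le> (\<Sum>l = 2..p. \<theta> (2 * l) / (2 * real l) * x ^ (2 * l))"
          unfolding e_def using p \<theta> by (intro member_le_sum[where f = "\<lambda>l. \<theta> (2 * l) / (2 * real l) * x ^ (2 * l)"]) auto
        ultimately show ?thesis unfolding V by (simp add: distrib_right)
      qed
      then show ?thesis by blast
    qed
  qed
  then show ?thesis by (rule that)
qed

text \<open>The common form removes \<open>k\<close> from the exponent. After expanding the square,
  the means produce the linear tilt, the coefficient sum the quadratic term, and the second moments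
  only a constant factor.\<close>

lemma stationary_exponent:
  assumes cf: "common_form M V \<alpha> s \<sigma> Vb \<alpha>b" and k: "k \<in> {1..M}"
    and \<mu>: "\<And>l. l \<in> {1..M} \<Longrightarrow> prob_space (\<mu> l)" "\<And>l. l \<in> {1..M} \<Longrightarrow> integrable (\<mu> l) (\<lambda>y. y)"
      "\<And>l. l \<in> {1..M} \<Longrightarrow> integrable (\<mu> l) (\<lambda>y. y\<^sup>2)"
  shows "exp (- (2 / (s k)\<^sup>2) * (V k x + (\<Sum>l = 1..M. a l * convolution_measure (\<lambda>x. \<alpha> k l / 2 * x\<^sup>2) (\<mu> l) x))) =
    gibbs_weight (\<lambda>x. Vb x + (\<Sum>l = 1..M. a l * \<alpha>b l) / 2 * x\<^sup>2) \<sigma> (\<Sum>l = 1..M. a l * \<alpha>b l * (LINT y|\<mu> l. y)) x *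
    exp (- (1 / \<sigma>\<^sup>2) * (\<Sum>l = 1..M. a l * \<alpha>b l * (LINT y|\<mu> l. y\<^sup>2)))"
proof -
  have \<alpha>: "\<alpha> k l / (s k)\<^sup>2 = \<alpha>b l / \<sigma>\<^sup>2" if "l \<in> {1..M}" for l
    using cf k that unfolding common_form_def by blast
  have Vk: "V k x / (s k)\<^sup>2 = Vb x / \<sigma>\<^sup>2" using cf k unfolding common_form_def by blast
  let ?m = "\<lambda>l. LINT y|\<mu> l. y" and ?Q = "\<lambda>l. LINT y|\<mu> l. y\<^sup>2"
  have conv: "2 / (s k)\<^sup>2 * (a l * convolution_measure (\<lambda>x. \<alpha> k l / 2 * x\<^sup>2) (\<mu> l) x) =
      a l * (\<alpha> k l / (s k)\<^sup>2) * (x\<^sup>2 - 2 * x * ?m l + ?Q l)" if "l \<in> {1..M}" for l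
  proof -
    have "2 / (s k)\<^sup>2 * (a l * (\<alpha> k l / 2 * E)) = a l * (\<alpha> k l / (s k)\<^sup>2) * E" for E by simp
    then show ?thesis unfolding convolution_measure_quadratic[OF \<mu>[OF that]] .
  qed
  have "(2 / (s k)\<^sup>2) * (V k x + (\<Sum>l = 1..M. a l * convolution_measure (\<lambda>x. \<alpha> k l / 2 * x\<^sup>2) (\<mu> l) x)) =
    2 * (V k x / (s k)\<^sup>2) + (\<Sum>l = 1..M. a l * (\<alpha> k l / (s k)\<^sup>2) * (x\<^sup>2 - 2 * x * ?m l + ?Q l))"
    by (subst distrib_left, subst sum_distrib_left, rule arg_cong2[where f = "(+)"], simp, rule sum.cong[OF refl conv], assumption)
  also have "\<dots> = 2 * (Vb x / \<sigma>\<^sup>2) + (\<Sum>l = 1..M. a l * (\<alpha>b l / \<sigma>\<^sup>2) * (x\<^sup>2 - 2 * x * ?m l + ?Q l))"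
    using \<alpha> by (simp add: Vk)
  also have "(\<Sum>l = 1..M. a l * (\<alpha>b l / \<sigma>\<^sup>2) * (x\<^sup>2 - 2 * x * ?m l + ?Q l)) =
     (1 / \<sigma>\<^sup>2) * ((\<Sum>l = 1..M. a l * \<alpha>b l) * x\<^sup>2 - 2 * x * (\<Sum>l = 1..M. a l * \<alpha>b l * ?m l)
       + (\<Sum>l = 1..M. a l * \<alpha>b l * ?Q l))"
    unfolding sum_distrib_left sum_distrib_right sum_subtractf[symmetric] sum.distrib[symmetric]
    by (intro sum.cong) (simp_all add: algebra_simps add_divide_distrib diff_divide_distrib)
  finally have eq: "(2 / (s k)\<^sup>2) * (V k x + (\<Sum>l = 1..M. a l * convolution_measure (\<lambda>x. \<alpha> k l / 2 * x\<^sup>2) (\<mu> l) x)) =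
    (2 / \<sigma>\<^sup>2) * (Vb x + (\<Sum>l = 1..M. a l * \<alpha>b l) / 2 * x\<^sup>2 - (\<Sum>l = 1..M. a l * \<alpha>b l * ?m l) * x)
    + (1 / \<sigma>\<^sup>2) * (\<Sum>l = 1..M. a l * \<alpha>b l * ?Q l)"
    by (simp add: algebra_simps add_divide_distrib diff_divide_distrib)
  show ?thesis
    unfolding gibbs_weight_def exp_add[symmetric] mult_minus_left eq by simp
qed

text \<open>From left to right, \<open>A\<close> is the weighted sum of the component means. The
  exponent makes every component the same Gibbs measure, so this sum collapses to \<beta> times the
  common mean, which is self-consistency. The converse uses the same exponent identity.\<close>

lemma stationary_state_iff:
  fixes V :: "nat \<Rightarrow> real \<Rightarrow> real"
  assumes sys: "multi_species_system M a V \<alpha> s" and cf: "common_form M V \<alpha> s \<sigma> Vb \<alpha>b"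
    and \<beta>: "\<beta> = (\<Sum>l = 1..M. a l * \<alpha>b l)" and dw: "double_well Vb q r \<beta>"
  shows "stationary_state M a V (\<lambda>i j x. \<alpha> i j / 2 * x\<^sup>2) s \<mu> \<longleftrightarrow>
    (\<exists>A. associated_state M (\<lambda>x. Vb x + \<beta> / 2 * x\<^sup>2) \<beta> \<sigma> A \<mu>)"
proof -
  interpret double_well Vb q r \<beta> by fact
  have V0: "(\<lambda>x. Vb x + \<beta> / 2 * x\<^sup>2) = U" by (simp add: U_def[abs_def])
  then have V0': "(\<lambda>x. Vb x + (\<Sum>l = 1..M. a l * \<alpha>b l) / 2 * x\<^sup>2) = U" by (simp only: \<beta>)
  have \<sigma>: "\<sigma> > 0" using cf by (simp add: common_form_def)
  show ?thesis unfolding V0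
  proof
    assume st: "stationary_state M a V (\<lambda>i j x. \<alpha> i j / 2 * x\<^sup>2) s \<mu>"
    have P: "prob_space (\<mu> l)" "sets (\<mu> l) = sets borel" if "l \<in> {1..M}" for l
      using st that unfolding stationary_state_def by blast+
    have I2: "integrable (\<mu> l) (\<lambda>y. y\<^sup>2)" if l: "l \<in> {1..M}" for l
    proof -
      \<comment> \<open>The self-interaction evaluated at the point 0, together with
        \<open>\<alpha> l l > 0\<close>, yields the finite second moment.\<close>
      have "integrable (\<mu> l) (\<lambda>y. \<alpha> l l / 2 * (0 - y)\<^sup>2)"
        using st l unfolding stationary_state_def by blast
      moreover have "\<alpha> l l > 0" using sys l unfolding multi_species_system_def by blast
      ultimately have "\<alpha> l l > 0" "integrable (\<mu> l) (\<lambda>y. (2 / \<alpha> l l) * (\<alpha> l l / 2 * (0 - y)\<^sup>2))"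
        by (auto intro: integrable_mult_right simp only:)
      moreover have "(2 / \<alpha> l l) * (\<alpha> l l / 2 * (0 - y)\<^sup>2) = y\<^sup>2" for y
        using \<open>\<alpha> l l > 0\<close> by simp
      ultimately show ?thesis by (simp only:)
    qed
    have I1: "integrable (\<mu> l) (\<lambda>y. y)" if "l \<in> {1..M}" for l
      using integrable_ident_if_square P I2 that by blast
    define A where "A = (\<Sum>l = 1..M. a l * \<alpha>b l * (LINT y|\<mu> l. y))"
    define c where "c = exp (- (1 / \<sigma>\<^sup>2) * (\<Sum>l = 1..M. a l * \<alpha>b l * (LINT y|\<mu> l. y\<^sup>2)))"
    have gibbs: "\<mu> k = gibbs_measure U \<sigma> A" if k: "k \<in> {1..M}" for k
    proof -
      obtain N where N: "N > 0" "\<mu> k = density lborel (\<lambda>x. ennreal (exp (- (2 / (s k)\<^sup>2) *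
          (V k x + (\<Sum>l = 1..M. a l * convolution_measure (\<lambda>x. \<alpha> k l / 2 * x\<^sup>2) (\<mu> l) x))) / N))"
        using st k unfolding stationary_state_def by blast
      have exponent: "exp (- (2 / (s k)\<^sup>2) * (V k x + (\<Sum>l = 1..M. a l *
          convolution_measure (\<lambda>x. \<alpha> k l / 2 * x\<^sup>2) (\<mu> l) x))) = gibbs_weight U \<sigma> A x * c" for x
        unfolding A_def c_def V0'[symmetric] by (rule stationary_exponent[OF cf k]) (fact P I1 I2)+
      have d: "\<mu> k = density lborel (\<lambda>x. ennreal (gibbs_weight U \<sigma> A x * (c / N)))"
        unfolding N(2) exponent by simp
      have "c / N = 1 / Z \<sigma> A"
        using density_normalization[of \<sigma> "c / N" A] \<sigma> N(1) P(1)[OF k] d by (simp add: c_def)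
      then show ?thesis using d by (simp add: gibbs_measure_def Z_def)
    qed
    have "A = \<beta> * (LINT y|gibbs_measure U \<sigma> A. y)"
      using gibbs by (subst A_def) (simp add: \<beta> sum_distrib_right)
    then have "self_consistent U \<beta> \<sigma> A" using self_consistent_iff_mean[OF \<sigma>] by blast
    moreover have "\<mu> = (\<lambda>k\<in>{1..M}. gibbs_measure U \<sigma> A)"
      using st gibbs unfolding stationary_state_def
      by (intro extensionalityI[of _ "{1..M}"]) auto
    ultimately show "\<exists>A. associated_state M U \<beta> \<sigma> A \<mu>" by (auto simp: associated_state_def)
  next
    assume "\<exists>A. associated_state M U \<beta> \<sigma> A \<mu>"
    then obtain A where A: "self_consistent U \<beta> \<sigma> A" and \<mu>: "\<mu> = (\<lambda>k\<in>{1..M}. gibbs_measure U \<sigma> A)"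
      by (auto simp: associated_state_def)
    let ?g = "gibbs_measure U \<sigma> A"
    have \<mu>k: "\<mu> k = ?g" if "k \<in> {1..M}" for k using that by (simp add: \<mu>)
    have I: "integrable ?g f" if "exp_bounded f" for f
      using integrable_gibbs_measure(1)[OF \<sigma> that] .
    have mean: "(\<Sum>l = 1..M. a l * \<alpha>b l * (LINT y|\<mu> l. y)) = A"
      using self_consistent_iff_mean[OF \<sigma>, of A] A
      by (simp add: \<mu>k \<beta> flip: sum_distrib_right)
    show "stationary_state M a V (\<lambda>i j x. \<alpha> i j / 2 * x\<^sup>2) s \<mu>"
      unfolding stationary_state_def
    proof (intro conjI ballI allI)
      show "\<mu> \<in> extensional {1..M}" by (simp add: \<mu>)
      fix k assume k: "k \<in> {1..M}"
      show "prob_space (\<mu> k)" using prob_space_gibbs_measure[OF \<sigma>] by (simp add: \<mu>k[OF k])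
      show "sets (\<mu> k) = sets borel" by (simp add: \<mu>k[OF k] gibbs_measure_def)
      show "integrable (\<mu> l) (\<lambda>y. \<alpha> k l / 2 * (x - y)\<^sup>2)" if "l \<in> {1..M}" for l x
        unfolding \<mu>k[OF that] by (intro I exp_bounded_mult exp_bounded_power exp_bounded_diff) auto
      define c where "c = exp (- (1 / \<sigma>\<^sup>2) * (\<Sum>l = 1..M. a l * \<alpha>b l * (LINT y|\<mu> l. y\<^sup>2)))"
      have "exp (- (2 / (s k)\<^sup>2) * (V k x + (\<Sum>l = 1..M. a l * convolution_measure (\<lambda>x. \<alpha> k l / 2 * x\<^sup>2) (\<mu> l) x))) =
        gibbs_weight U \<sigma> (\<Sum>l = 1..M. a l * \<alpha>b l * (LINT y|\<mu> l. y)) x * c" for x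
        unfolding c_def V0'[symmetric]
        by (rule stationary_exponent[OF cf k]; (subst \<mu>k, assumption); intro I prob_space_gibbs_measure[OF \<sigma>]) auto
      note exponent = this[unfolded mean]
      \<comment> \<open>The witness \<open>Z \<sigma> A * c\<close> also cancels the constant factor
        left by the second moments.\<close>
      show "\<exists>N>0. \<mu> k = density lborel (\<lambda>x. ennreal (exp (- (2 / (s k)\<^sup>2) *
          (V k x + (\<Sum>l = 1..M. a l * convolution_measure (\<lambda>x. \<alpha> k l / 2 * x\<^sup>2) (\<mu> l) x))) / N))"
        unfolding exponent \<mu>k[OF k] using Z_pos[OF \<sigma>, of A]
        by (intro exI[of _ "Z \<sigma> A * c"]) (simp add: gibbs_measure_def Z_def c_def)
    qed
  qed
qed

text \<open>Quantifying the function \<open>\<sigma>\<^sub>c\<close> before all data expresses that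
  the critical value depends on \<open>Vb\<close> and \<beta> alone, while \<sigma> varies.\<close>

theorem theorem3p2:
  "\<exists>\<sigma>\<^sub>c :: (real \<Rightarrow> real) \<Rightarrow> real \<Rightarrow> real.
    \<forall>(M :: nat) (a :: nat \<Rightarrow> real) (V :: nat \<Rightarrow> real \<Rightarrow> real) (\<alpha> :: nat \<Rightarrow> nat \<Rightarrow> real) (s :: nat \<Rightarrow> real)
     (F :: nat \<Rightarrow> nat \<Rightarrow> real \<Rightarrow> real) (\<sigma> :: real) (Vb :: real \<Rightarrow> real) (\<alpha>b :: nat \<Rightarrow> real)
     (\<beta> :: real) (V0 :: real \<Rightarrow> real) (S :: (nat \<Rightarrow> real measure) set).
      multi_species_system M a V \<alpha> s \<longrightarrow>
      F = (\<lambda>i j x. \<alpha> i j / 2 * x\<^sup>2) \<longrightarrow>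
      structural_condition M V \<alpha> s \<longrightarrow>
      common_form M V \<alpha> s \<sigma> Vb \<alpha>b \<longrightarrow>
      \<beta> = (\<Sum>l = 1..M. a l * \<alpha>b l) \<longrightarrow>
      V0 = (\<lambda>x. Vb x + \<beta> / 2 * x\<^sup>2) \<longrightarrow>
      S = {\<mu>. stationary_state M a V F s \<mu>} \<longrightarrow>
        (\<forall>\<mu>\<in>S. \<exists>A. associated_state M V0 \<beta> \<sigma> A \<mu>) \<and>
        \<sigma>\<^sub>c Vb \<beta> > 0 \<and>
        (\<sigma> \<ge> \<sigma>\<^sub>c Vb \<beta> \<longrightarrow> (\<exists>\<mu>. S = {\<mu>} \<and> associated_state M V0 \<beta> \<sigma> 0 \<mu>)) \<and>
        (\<sigma> < \<sigma>\<^sub>c Vb \<beta> \<longrightarrow>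
          (\<exists>\<mu>\<^sub>0 \<mu>\<^sub>1 \<mu>\<^sub>2 A\<^sub>1 A\<^sub>2. S = {\<mu>\<^sub>0, \<mu>\<^sub>1, \<mu>\<^sub>2} \<and> card S = 3 \<and> A\<^sub>1 > 0 \<and> A\<^sub>2 < 0 \<and>
             associated_state M V0 \<beta> \<sigma> 0 \<mu>\<^sub>0 \<and>
             associated_state M V0 \<beta> \<sigma> A\<^sub>1 \<mu>\<^sub>1 \<and>
             associated_state M V0 \<beta> \<sigma> A\<^sub>2 \<mu>\<^sub>2)) \<and>
        (\<forall>r>0. critical_equation V0 \<beta> r \<longleftrightarrow> r = \<sigma>\<^sub>c Vb \<beta>)"
proof -
  \<comment> \<open>The critical equation involves only \<open>W\<close> and \<beta>, so choosing
    one of its solutions gives a witness fixed before the system. For a double well the solution is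
    unique, which identifies the choice.\<close>
  define crit where
    "crit = (\<lambda>W \<beta>. SOME \<sigma>. \<sigma> > 0 \<and> critical_equation (\<lambda>x. W x + \<beta> / 2 * x\<^sup>2) \<beta> \<sigma>)"
  show ?thesis
  proof (intro exI[of _ crit] allI impI)
    fix M :: nat and a :: "nat \<Rightarrow> real" and V :: "nat \<Rightarrow> real \<Rightarrow> real" and \<alpha> :: "nat \<Rightarrow> nat \<Rightarrow> real"
      and s :: "nat \<Rightarrow> real" and F :: "nat \<Rightarrow> nat \<Rightarrow> real \<Rightarrow> real" and \<sigma> :: real and Vb :: "real \<Rightarrow> real"
      and \<alpha>b :: "nat \<Rightarrow> real" and \<beta> :: real and V0 :: "real \<Rightarrow> real" and S :: "(nat \<Rightarrow> real measure) set"
    assume sys: "multi_species_system M a V \<alpha> s" and F: "F = (\<lambda>i j x. \<alpha> i j / 2 * x\<^sup>2)"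
      and cf: "common_form M V \<alpha> s \<sigma> Vb \<alpha>b"
      and \<beta>: "\<beta> = (\<Sum>l = 1..M. a l * \<alpha>b l)" and V0: "V0 = (\<lambda>x. Vb x + \<beta> / 2 * x\<^sup>2)"
      and S: "S = {\<mu>. stationary_state M a V F s \<mu>}"
    have M: "1 \<le> M" and s1: "s 1 > 0" and V1: "confining_potential (V 1)"
      using sys by (auto simp: multi_species_system_def)
    have \<sigma>: "\<sigma> > 0" using cf by (simp add: common_form_def)
    have scale: "Vb x = (\<sigma>\<^sup>2 / (s 1)\<^sup>2) * V 1 x" for x
    proof -
      have "V 1 x / (s 1)\<^sup>2 = Vb x / \<sigma>\<^sup>2" using cf M unfolding common_form_def by auto
      then show ?thesis using \<sigma> s1 by (simp add: field_simps)
    qed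
    have "confining_potential Vb"
      by (rule confining_potential_scale[OF V1 _ scale]) (use s1 \<sigma> in simp)
    \<comment> \<open>The common form carries \<open>\<alpha> l l > 0\<close> over to
      \<open>\<alpha>b l > 0\<close>, and weights summing to 1 cannot all vanish.\<close>
    moreover have "\<beta> > 0"
    proof -
      have \<alpha>b: "\<alpha>b l > 0" if l: "l \<in> {1..M}" for l
      proof -
        have "\<alpha> l l > 0" "s l > 0" using sys l unfolding multi_species_system_def by blast+
        moreover have "\<alpha> l l / (s l)\<^sup>2 = \<alpha>b l / \<sigma>\<^sup>2" using cf l unfolding common_form_def by blast
        ultimately have "\<alpha>b l / \<sigma>\<^sup>2 > 0" by (metis divide_pos_pos zero_less_power)
        then show ?thesis using \<sigma> by (simp add: zero_less_divide_iff)
      qed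
      have a: "a l \<ge> 0" if "l \<in> {1..M}" for l using sys that unfolding multi_species_system_def by blast
      have "(\<Sum>l = 1..M. a l) = 1" using sys unfolding multi_species_system_def by blast
      then obtain l where l: "l \<in> {1..M}" "a l \<noteq> 0" by (metis sum.neutral zero_neq_one)
      then show ?thesis unfolding \<beta>
        using a \<alpha>b by (intro sum_pos2[of _ l]) (auto simp: less_le)
    qed
    ultimately obtain q r where dw: "double_well Vb q r \<beta>" by (rule confining_potential_double_well)
    interpret double_well Vb q r \<beta> by fact
    have V0_U: "V0 = U" by (simp add: V0 U_def[abs_def])
    obtain \<sigma>\<^sub>c where \<sigma>\<^sub>c: "\<sigma>\<^sub>c > 0" "\<And>\<sigma>. \<sigma> > 0 \<Longrightarrow> critical_equation U \<beta> \<sigma> \<longleftrightarrow> \<sigma> = \<sigma>\<^sub>c"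
      "\<And>\<sigma>. \<sigma> > 0 \<Longrightarrow> G (2 / \<sigma>\<^sup>2) < 0 \<longleftrightarrow> \<sigma> < \<sigma>\<^sub>c"
      using critical_diffusion by blast
    have crit: "crit Vb \<beta> = \<sigma>\<^sub>c"
      unfolding crit_def V0[symmetric] V0_U by (rule some_equality) (use \<sigma>\<^sub>c(1,2) in auto)
    have S_iff: "\<mu> \<in> S \<longleftrightarrow> (\<exists>A. associated_state M V0 \<beta> \<sigma> A \<mu>)" for \<mu>
      unfolding S mem_Collect_eq F V0 by (rule stationary_state_iff[OF sys cf \<beta> dw])
    define state where "state = (\<lambda>A. \<lambda>k\<in>{1..M}. gibbs_measure U \<sigma> A)"
    have assoc: "associated_state M V0 \<beta> \<sigma> A \<mu> \<longleftrightarrow> K (2 / \<sigma>\<^sup>2) (2 / \<sigma>\<^sup>2 * A) = 0 \<and> \<mu> = state A" for A \<mu>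
      using self_consistent_iff_K[OF \<sigma>] by (simp add: associated_state_def V0_U state_def)
    have \<tau>: "2 / \<sigma>\<^sup>2 > 0" using \<sigma> by simp
    have uniq: "\<exists>\<mu>. S = {\<mu>} \<and> associated_state M V0 \<beta> \<sigma> 0 \<mu>" if "\<sigma> \<ge> \<sigma>\<^sub>c"
    proof -
      have "G (2 / \<sigma>\<^sup>2) \<ge> 0" using \<sigma>\<^sub>c(3)[OF \<sigma>] that by auto
      then have "K (2 / \<sigma>\<^sup>2) (2 / \<sigma>\<^sup>2 * A) = 0 \<longleftrightarrow> A = 0" for A
        using K_zeros_supercritical[OF \<tau>] \<sigma> by simp
      then have "associated_state M V0 \<beta> \<sigma> A \<mu> \<longleftrightarrow> A = 0 \<and> \<mu> = state 0" for A \<mu>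
        by (auto simp: assoc)
      then show ?thesis using S_iff by blast
    qed
    have three: "\<exists>\<mu>\<^sub>0 \<mu>\<^sub>1 \<mu>\<^sub>2 A\<^sub>1 A\<^sub>2. S = {\<mu>\<^sub>0, \<mu>\<^sub>1, \<mu>\<^sub>2} \<and> card S = 3 \<and> A\<^sub>1 > 0 \<and> A\<^sub>2 < 0 \<and>
        associated_state M V0 \<beta> \<sigma> 0 \<mu>\<^sub>0 \<and> associated_state M V0 \<beta> \<sigma> A\<^sub>1 \<mu>\<^sub>1 \<and> associated_state M V0 \<beta> \<sigma> A\<^sub>2 \<mu>\<^sub>2"
      if "\<sigma> < \<sigma>\<^sub>c"
    proof -
      have "G (2 / \<sigma>\<^sup>2) < 0" using \<sigma>\<^sub>c(3)[OF \<sigma>] that by auto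
      then obtain b where b: "b > 0" "\<And>c. K (2 / \<sigma>\<^sup>2) c = 0 \<longleftrightarrow> c \<in> {0, b, - b}"
        using K_zeros_subcritical[OF \<tau>] by blast
      \<comment> \<open>\<open>K\<close> is evaluated at \<open>2 / \<sigma>\<^sup>2 * A\<close>, so
        its zero \<open>b\<close> corresponds to this tilt.\<close>
      define A where "A = b * \<sigma>\<^sup>2 / 2"
      have A: "A > 0" using b(1) \<sigma> by (simp add: A_def)
      have "2 / \<sigma>\<^sup>2 * B = b \<longleftrightarrow> B = A" "2 / \<sigma>\<^sup>2 * B = - b \<longleftrightarrow> B = - A" for B
        using \<sigma> by (auto simp: A_def field_simps)
      then have zeros: "associated_state M V0 \<beta> \<sigma> B \<mu> \<longleftrightarrow> B \<in> {0, A, - A} \<and> \<mu> = state B" for B \<mu>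
        using \<sigma> by (auto simp: assoc b(2))
      have inj: "state B \<noteq> state C" if "B \<in> {0, A, - A}" "C \<in> {0, A, - A}" "B \<noteq> C" for B C
        using associated_state_unique[OF \<sigma> M, folded V0_U] zeros that by metis
      have "S = {state 0, state A, state (- A)}" using S_iff zeros by auto
      moreover have "card {state 0, state A, state (- A)} = 3"
        using inj[of 0 A] inj[of 0 "- A"] inj[of A "- A"] A by simp
      ultimately show ?thesis using A zeros
        by (intro exI[of _ "state 0"] exI[of _ "state A"] exI[of _ "state (- A)"] exI[of _ A] exI[of _ "- A"]) simp
    qed
    show "(\<forall>\<mu>\<in>S. \<exists>A. associated_state M V0 \<beta> \<sigma> A \<mu>) \<and>
        crit Vb \<beta> > 0 \<and>
        (\<sigma> \<ge> crit Vb \<beta> \<longrightarrow> (\<exists>\<mu>. S = {\<mu>} \<and> associated_state M V0 \<beta> \<sigma> 0 \<mu>)) \<and>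
        (\<sigma> < crit Vb \<beta> \<longrightarrow>
          (\<exists>\<mu>\<^sub>0 \<mu>\<^sub>1 \<mu>\<^sub>2 A\<^sub>1 A\<^sub>2. S = {\<mu>\<^sub>0, \<mu>\<^sub>1, \<mu>\<^sub>2} \<and> card S = 3 \<and> A\<^sub>1 > 0 \<and> A\<^sub>2 < 0 \<and>
             associated_state M V0 \<beta> \<sigma> 0 \<mu>\<^sub>0 \<and>
             associated_state M V0 \<beta> \<sigma> A\<^sub>1 \<mu>\<^sub>1 \<and>
             associated_state M V0 \<beta> \<sigma> A\<^sub>2 \<mu>\<^sub>2)) \<and>
        (\<forall>r>0. critical_equation V0 \<beta> r \<longleftrightarrow> r = crit Vb \<beta>)"
      unfolding crit
    proof (intro conjI)
      show "\<forall>r>0. critical_equation V0 \<beta> r \<longleftrightarrow> r = \<sigma>\<^sub>c" using \<sigma>\<^sub>c(2) by (simp add: V0_U)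
    qed (use S_iff \<sigma>\<^sub>c(1) uniq three in blast)+
  qed
qed

end
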